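(* There exists a hereditary class $\mathcal{G}$ of graphs such that every graph in $\mathcal{G}$ is perfect, every graph in $\mathcal{G}$ is either cobipartite (and therefore $2$-clique-colorable) or admits a clique-cutset, and $\mathcal{G}$ contains graphs of arbitrarily large clique-chromatic number (so there is no positive integer $d$ such that every graph in $\mathcal{G}$ is $d$-clique-colorable).
   Context: All graphs are simple, finite, and non-null (at least one vertex). A clique of a graph $G$ is a (possibly empty) set of pairwise adjacent vertices of $G$. A set of vertices is monochromatic if all its vertices received the same color. A clique-coloring of $G$ is an assignment of colors to the vertices of $G$ such that no inclusion-wise maximal clique of $G$ of size at least two is monochromatic. A $k$-clique-coloring of $G$ is a clique-coloring $\varphi: V(G) \to \{1,\ldots,k\}$, and $G$ is $k$-clique-colorable if it has a $k$-clique-coloring (not all colors need be used). The clique-chromatic number $\chi_C(G)$ is the smallest integer $k$ such that $G$ is $k$-clique-colorable. The clique number $\omega(G)$ is the maximum size of a clique of $G$. A graph $G$ is perfect if every induced subgraph $H$ of $G$ satisfies $\chi(H) = \omega(H)$, where $\chi$ denotes the usual chromatic number. A cobipartite graph is a graph whose complement is bipartite. A hereditary class is a class of graphs closed under taking induced subgraphs. A clique-cutset of a graph is a (possibly empty) clique whose deletion from the graph yields a disconnected graph. *)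

theory Defs
  imports "Graph_Theory.Graph_Theory"
begin

text \<open>
  As in the library, an undirected graph is a symmetric digraph: the edge \<open>uv\<close> is the pair of arcs
  \<open>(u, v)\<close>, \<open>(v, u)\<close>, and \<^locale>\<open>pair_graph\<close> says finite, loopless, symmetric.  The null graph is
  excluded.
\<close>

definition simple_graph :: "'a pair_pre_digraph \<Rightarrow> bool" where
  "simple_graph G \<longleftrightarrow> pair_graph G \<and> pverts G \<noteq> {}"

definition is_clique :: "'a pair_pre_digraph \<Rightarrow> 'a set \<Rightarrow> bool" where
  "is_clique G K \<longleftrightarrow> K \<subseteq> pverts G \<and> (\<forall>u\<in>K. \<forall>v\<in>K. u \<noteq> v \<longrightarrow> (u, v) \<in> parcs G)"

definition maximal_clique :: "'a pair_pre_digraph \<Rightarrow> 'a set \<Rightarrow> bool" where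
  "maximal_clique G K \<longleftrightarrow> is_clique G K \<and> (\<forall>L. is_clique G L \<and> K \<subseteq> L \<longrightarrow> L = K)"

definition clique_number :: "'a pair_pre_digraph \<Rightarrow> nat" where
  "clique_number G = Max (card ` {K. is_clique G K})"

definition proper_coloring :: "'a pair_pre_digraph \<Rightarrow> nat \<Rightarrow> ('a \<Rightarrow> nat) \<Rightarrow> bool" where
  "proper_coloring G k \<phi> \<longleftrightarrow>
     \<phi> ` pverts G \<subseteq> {1..k} \<and> (\<forall>(u, v)\<in>parcs G. \<phi> u \<noteq> \<phi> v)"

definition chromatic_number :: "'a pair_pre_digraph \<Rightarrow> nat" where
  "chromatic_number G = (LEAST k. \<exists>\<phi>. proper_coloring G k \<phi>)"

definition monochromatic :: "('a \<Rightarrow> nat) \<Rightarrow> 'a set \<Rightarrow> bool" where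
  "monochromatic \<phi> K \<longleftrightarrow> (\<exists>c. \<forall>v\<in>K. \<phi> v = c)"

definition clique_coloring :: "'a pair_pre_digraph \<Rightarrow> nat \<Rightarrow> ('a \<Rightarrow> nat) \<Rightarrow> bool" where
  "clique_coloring G k \<phi> \<longleftrightarrow>
     \<phi> ` pverts G \<subseteq> {1..k} \<and>
     (\<forall>K. maximal_clique G K \<and> card K \<ge> 2 \<longrightarrow> \<not> monochromatic \<phi> K)"

definition clique_colorable :: "nat \<Rightarrow> 'a pair_pre_digraph \<Rightarrow> bool" where
  "clique_colorable k G \<longleftrightarrow> (\<exists>\<phi>. clique_coloring G k \<phi>)"

definition clique_chromatic_number :: "'a pair_pre_digraph \<Rightarrow> nat" where
  "clique_chromatic_number G = (LEAST k. clique_colorable k G)"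

text \<open>Non-null induced subgraphs only, since graphs are non-null.\<close>

definition is_induced_subgraph :: "'a pair_pre_digraph \<Rightarrow> 'a pair_pre_digraph \<Rightarrow> bool" where
  "is_induced_subgraph H G \<longleftrightarrow>
     induced_subgraph (with_proj H) (with_proj G) \<and> pverts H \<noteq> {}"

definition perfect_graph :: "'a pair_pre_digraph \<Rightarrow> bool" where
  "perfect_graph G \<longleftrightarrow>
     (\<forall>H. is_induced_subgraph H G \<longrightarrow> chromatic_number H = clique_number H)"

definition complement_graph :: "'a pair_pre_digraph \<Rightarrow> 'a pair_pre_digraph" where
  "complement_graph G =
     \<lparr> pverts = pverts G,
       parcs = {(u, v) \<in> pverts G \<times> pverts G. u \<noteq> v \<and> (u, v) \<notin> parcs G} \<rparr>"

definition bipartite :: "'a pair_pre_digraph \<Rightarrow> bool" where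
  "bipartite G \<longleftrightarrow>
     (\<exists>A B. A \<union> B = pverts G \<and> A \<inter> B = {} \<and> parcs G \<subseteq> A \<times> B \<union> B \<times> A)"

definition cobipartite :: "'a pair_pre_digraph \<Rightarrow> bool" where
  "cobipartite G \<longleftrightarrow> bipartite (complement_graph G)"

text \<open>
  The library's \<^const>\<open>connected\<close> is false for the null graph, so deleting all vertices of a complete
  graph must be ruled out explicitly.
\<close>

definition clique_cutset :: "'a pair_pre_digraph \<Rightarrow> 'a set \<Rightarrow> bool" where
  "clique_cutset G K \<longleftrightarrow>
     is_clique G K \<and> pverts G - K \<noteq> {} \<and> \<not> connected (with_proj G \<restriction> (pverts G - K))"

text \<open>
  Graph classes are closed under isomorphism, as usual; with \<^typ>\<open>nat\<close> as the vertex type, they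
  contain copies of arbitrary finite graphs.
\<close>

definition graph_class :: "'a pair_pre_digraph set \<Rightarrow> bool" where
  "graph_class \<G> \<longleftrightarrow>
     (\<forall>G\<in>\<G>. simple_graph G) \<and>
     (\<forall>G\<in>\<G>. \<forall>H. digraph_iso (with_proj G) (with_proj H) \<longrightarrow> H \<in> \<G>)"

definition hereditary_class :: "'a pair_pre_digraph set \<Rightarrow> bool" where
  "hereditary_class \<G> \<longleftrightarrow>
     graph_class \<G> \<and> (\<forall>G\<in>\<G>. \<forall>H. is_induced_subgraph H G \<longrightarrow> H \<in> \<G>)"

end

theory Submission
  imports Defs
begin

text \<open>
  The class consists of the graphs obtained from cobipartite graphs by repeatedly gluing two graphs
  along a common clique.  Gluing preserves perfection, because the optimal colorings of the two parts
  can be made to agree on the clique.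

  To defeat \<open>d\<close> colors, one forces cliques in which more and more colors are frequent.  Given disjoint
  sets \<open>Q i\<close> (\<open>i < k\<close>) of color \<open>c i\<close> whose union is a clique, glue a cobipartite graph on \<open>\<Union>i<k. Q i\<close>
  and a large new clique \<open>B\<close>, designed so that either one of its maximal cliques is monochromatic or some
  new color is frequent in \<open>B\<close>, on a set with many common neighbours in each \<open>Q i\<close>.  The second
  alternative gives a clique with \<open>k + 1\<close> frequent colors.  As the colors are unknown, the next stage is
  glued to every candidate for this clique.  It must end in the first alternative because only \<open>d\<close>
  colors are available.
\<close>

section \<open>Graphs glued along cliques\<close>

lemma pair_graph_iff:
  "pair_graph G \<longleftrightarrow>
     finite (pverts G) \<and> parcs G \<subseteq> pverts G \<times> pverts G \<and> sym (parcs G) \<and> irrefl (parcs G)"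
proof
  assume "pair_graph G"
  then interpret pair_graph G .
  have "parcs G \<subseteq> pverts G \<times> pverts G"
    using wellformed' by auto
  moreover have "sym (parcs G)"
    using arcs_symmetric by (rule symI)
  moreover have "irrefl (parcs G)"
    using no_loops by (fastforce simp: irrefl_def)
  ultimately show
    "finite (pverts G) \<and> parcs G \<subseteq> pverts G \<times> pverts G \<and> sym (parcs G) \<and> irrefl (parcs G)"
    using pair_finite_verts by blast
next
  assume a: "finite (pverts G) \<and> parcs G \<subseteq> pverts G \<times> pverts G \<and> sym (parcs G) \<and> irrefl (parcs G)"
  then have "finite (parcs G)"
    by (meson finite_SigmaI finite_subset)
  with a show "pair_graph G"
    by unfold_locales (auto simp: symmetric_def irrefl_def)
qed

lemma cobipartite_iff:
  "cobipartite G \<longleftrightarrow>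
    (\<exists>A B. A \<union> B = pverts G \<and> A \<inter> B = {} \<and> is_clique G A \<and> is_clique G B)"
proof -
  have "parcs (complement_graph G) \<subseteq> A \<times> B \<union> B \<times> A \<longleftrightarrow> is_clique G A \<and> is_clique G B"
    if AB: "A \<union> B = pverts G" "A \<inter> B = {}" for A B
  proof
    assume *: "parcs (complement_graph G) \<subseteq> A \<times> B \<union> B \<times> A"
    have "(u, v) \<in> parcs G"
      if "u \<in> pverts G" "v \<in> pverts G" "u \<noteq> v" "(u, v) \<notin> A \<times> B \<union> B \<times> A" for u v
      using that subsetD[OF *, of "(u, v)"] by (auto simp: complement_graph_def)
    then show "is_clique G A \<and> is_clique G B"
      using AB unfolding is_clique_def by blast
  next
    assume *: "is_clique G A \<and> is_clique G B"
    show "parcs (complement_graph G) \<subseteq> A \<times> B \<union> B \<times> A"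
    proof (rule subrelI)
      fix u v
      assume "(u, v) \<in> parcs (complement_graph G)"
      then have "u \<in> A \<union> B" "v \<in> A \<union> B" "u \<noteq> v" "(u, v) \<notin> parcs G"
        using AB by (auto simp: complement_graph_def)
      with * show "(u, v) \<in> A \<times> B \<union> B \<times> A"
        unfolding is_clique_def by blast
    qed
  qed
  moreover have "pverts (complement_graph G) = pverts G"
    by (simp add: complement_graph_def)
  ultimately show ?thesis
    unfolding cobipartite_def bipartite_def by metis
qed

definition induce :: "'a pair_pre_digraph \<Rightarrow> 'a set \<Rightarrow> 'a pair_pre_digraph" where
  "induce G S = \<lparr> pverts = pverts G \<inter> S, parcs = parcs G \<inter> S \<times> S \<rparr>"

definition graph_union :: "'a pair_pre_digraph \<Rightarrow> 'a pair_pre_digraph \<Rightarrow> 'a pair_pre_digraph" where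
  "graph_union G H = \<lparr> pverts = pverts G \<union> pverts H, parcs = parcs G \<union> parcs H \<rparr>"

definition map_graph :: "('a \<Rightarrow> 'b) \<Rightarrow> 'a pair_pre_digraph \<Rightarrow> 'b pair_pre_digraph" where
  "map_graph f G = \<lparr> pverts = f ` pverts G, parcs = map_prod f f ` parcs G \<rparr>"

lemma induce_simps [simp]:
  "pverts (induce G S) = pverts G \<inter> S" "parcs (induce G S) = parcs G \<inter> S \<times> S"
  by (simp_all add: induce_def)

lemma graph_union_simps [simp]:
  "pverts (graph_union G H) = pverts G \<union> pverts H"
  "parcs (graph_union G H) = parcs G \<union> parcs H"
  by (simp_all add: graph_union_def)

lemma map_graph_simps [simp]:
  "pverts (map_graph f G) = f ` pverts G" "parcs (map_graph f G) = map_prod f f ` parcs G"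
  by (simp_all add: map_graph_def)

lemma is_induced_subgraphD:
  assumes "is_induced_subgraph H G"
  shows "H = induce G (pverts H)" "pverts H \<noteq> {}"
  using assms unfolding is_induced_subgraph_def induced_subgraph_def subgraph_def
  by (auto simp: induce_def intro!: pair_pre_digraph.equality)

text \<open>A library isomorphism carries separate maps for vertices, arcs, tails and heads. Both
  graphs here have \<open>fst\<close> and \<open>snd\<close> as tail and head, so the vertex map
  determines the arc map.\<close>

lemma digraph_iso_with_projD:
  assumes "digraph_iso (with_proj G) (with_proj H)"
  obtains f where "inj_on f (pverts G)" "H = map_graph f G"
proof -
  from assms obtain h where h: "pre_digraph.digraph_isomorphism (with_proj G) h"
    and H: "with_proj H = app_iso h (with_proj G)"
    unfolding digraph_iso_def by blast
  let ?f = "iso_verts h"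
  have "inj_on ?f (pverts G)"
    using h unfolding pre_digraph.digraph_isomorphism_def by simp
  moreover have verts: "pverts H = ?f ` pverts G"
    using arg_cong[OF H, of verts] by simp
  moreover have arcs: "parcs H = iso_arcs h ` parcs G"
    using arg_cong[OF H, of arcs] by simp
  moreover have "iso_tail h = fst" "iso_head h = snd"
    using arg_cong[OF H, of tail] arg_cong[OF H, of head] by simp_all
  then have "iso_arcs h e = map_prod ?f ?f e" if "e \<in> parcs G" for e
    using h that unfolding pre_digraph.digraph_isomorphism_def
    by (auto simp: prod_eq_iff)
  ultimately show thesis
    using that[of ?f] by (auto simp: map_graph_def intro!: pair_pre_digraph.equality)
qed

section \<open>The class of graphs and its closure properties\<close>

text \<open>Neither graph has to extend beyond the other, and the intersection may be empty. These
  degenerate cases arise when passing to an induced subgraph, so admitting them gives heredity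
  without case distinctions. The null graph is included as well.\<close>

inductive clique_glued :: "'a pair_pre_digraph \<Rightarrow> bool" where
  cobipartite: "pair_graph G \<Longrightarrow> cobipartite G \<Longrightarrow> clique_glued G"
| glue: "clique_glued G \<Longrightarrow> clique_glued H \<Longrightarrow> is_clique G (pverts G \<inter> pverts H) \<Longrightarrow>
    is_clique H (pverts G \<inter> pverts H) \<Longrightarrow> clique_glued (graph_union G H)"

lemma clique_glued_pair_graph: "clique_glued G \<Longrightarrow> pair_graph G"
proof (induction rule: clique_glued.induct)
  case (glue G H)
  then show ?case
    unfolding pair_graph_iff by (auto simp: irrefl_def sym_def)
qed

lemma clique_glued_arcs:
  assumes "clique_glued G" "(u, v) \<in> parcs G"
  shows "u \<in> pverts G" "v \<in> pverts G" "u \<noteq> v" "(v, u) \<in> parcs G"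
  using assms clique_glued_pair_graph[of G] unfolding pair_graph_iff
  by (auto simp: irrefl_def sym_def)

lemma clique_glued_finite: "clique_glued G \<Longrightarrow> finite (pverts G)"
  using clique_glued_pair_graph pair_graph_iff by blast

lemma pair_graph_induce: "pair_graph G \<Longrightarrow> pair_graph (induce G S)"
  unfolding pair_graph_iff by (auto simp: irrefl_def sym_def)

lemma is_clique_induce: "is_clique G K \<Longrightarrow> is_clique (induce G S) (K \<inter> S)"
  unfolding is_clique_def by auto

text \<open>Restriction to \<open>S\<close> commutes with gluing, and cliques stay cliques when
  restricted.\<close>

lemma clique_glued_induce: "clique_glued G \<Longrightarrow> clique_glued (induce G S)"
proof (induction rule: clique_glued.induct)
  case (cobipartite G)
  from cobipartite.hyps(2) obtain A B
    where "A \<union> B = pverts G" "A \<inter> B = {}" "is_clique G A" "is_clique G B"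
    unfolding cobipartite_iff by blast
  then have "A \<inter> S \<union> B \<inter> S = pverts (induce G S)" "(A \<inter> S) \<inter> (B \<inter> S) = {}"
    "is_clique (induce G S) (A \<inter> S)" "is_clique (induce G S) (B \<inter> S)"
    using is_clique_induce[of G _ S] by auto
  then have "cobipartite (induce G S)"
    unfolding cobipartite_iff by blast
  with cobipartite.hyps(1) show ?case
    by (intro clique_glued.cobipartite pair_graph_induce)
next
  case (glue G H)
  have int: "pverts (induce G S) \<inter> pverts (induce H S) = pverts G \<inter> pverts H \<inter> S"
    by auto
  have "clique_glued (graph_union (induce G S) (induce H S))"
    by (rule clique_glued.glue) (use glue in \<open>simp_all only: int is_clique_induce\<close>)
  moreover have "graph_union (induce G S) (induce H S) = induce (graph_union G H) S"
    by (auto intro!: pair_pre_digraph.equality)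
  ultimately show ?case
    by simp
qed

lemma pair_graph_map:
  assumes "pair_graph G" "inj_on f (pverts G)"
  shows "pair_graph (map_graph f G)"
proof -
  have G: "finite (pverts G)" "sym (parcs G)"
    "\<And>u v. (u, v) \<in> parcs G \<Longrightarrow> u \<in> pverts G \<and> v \<in> pverts G \<and> u \<noteq> v"
    using assms(1) unfolding pair_graph_iff by (auto simp: irrefl_def)
  then show ?thesis
    using assms(2) unfolding pair_graph_iff
    by (fastforce simp: irrefl_def sym_def dest: inj_onD)
qed

lemma is_clique_map:
  "is_clique G K \<Longrightarrow> is_clique (map_graph f G) (f ` K)"
  unfolding is_clique_def by (auto simp: map_prod_def) force

lemma clique_glued_map:
  "clique_glued G \<Longrightarrow> inj_on f (pverts G) \<Longrightarrow> clique_glued (map_graph f G)"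
proof (induction rule: clique_glued.induct)
  case (cobipartite G)
  from cobipartite.hyps(2) obtain A B
    where AB: "A \<union> B = pverts G" "A \<inter> B = {}" "is_clique G A" "is_clique G B"
    unfolding cobipartite_iff by blast
  then have "f ` A \<union> f ` B = pverts (map_graph f G)" "f ` A \<inter> f ` B = {}"
    using cobipartite.prems inj_on_image_Int[of f "pverts G" A B] by auto
  with is_clique_map[OF AB(3)] is_clique_map[OF AB(4)] have "cobipartite (map_graph f G)"
    unfolding cobipartite_iff by blast
  with cobipartite show ?case
    by (intro clique_glued.cobipartite pair_graph_map)
next
  case (glue G H)
  then have inj: "inj_on f (pverts G)" "inj_on f (pverts H)"
    by (auto intro: inj_on_subset)
  \<comment> \<open>Injectivity on the union of both vertex sets, and not merely on each, makes the
    images meet exactly in the image of the intersection.\<close>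
  have int: "pverts (map_graph f G) \<inter> pverts (map_graph f H) = f ` (pverts G \<inter> pverts H)"
    using glue.prems by (simp add: inj_on_image_Int[of f "pverts G \<union> pverts H"])
  have "clique_glued (graph_union (map_graph f G) (map_graph f H))"
    by (rule clique_glued.glue) (use glue inj in \<open>simp_all only: int is_clique_map\<close>)
  moreover have "graph_union (map_graph f G) (map_graph f H) = map_graph f (graph_union G H)"
    by (auto intro!: pair_pre_digraph.equality)
  ultimately show ?case
    by simp
qed

section \<open>Clique-cutsets\<close>

text \<open>No arc crosses the border of \<open>U\<close>, so a walk that starts in \<open>U\<close>
  never leaves it.\<close>

lemma not_connected_if_separated:
  assumes "u \<in> U" "U \<subseteq> verts G" "v \<in> verts G - U"
    and "\<And>e. e \<in> arcs G \<Longrightarrow> tail G e \<in> U \<longleftrightarrow> head G e \<in> U"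
  shows "\<not> connected G"
proof
  assume "connected G"
  then have "(u, v) \<in> rtrancl_on (verts G) (parcs (mk_symmetric G))"
    using assms(1-3) unfolding connected_def strongly_connected_def reachable_def
    by (auto simp: mk_symmetric_def)
  then have "v \<in> U"
    by (induction rule: rtrancl_on_induct) (use assms in \<open>auto simp: mk_symmetric_def\<close>)
  with assms show False
    by simp
qed

text \<open>If each part has a vertex outside the other, the gluing clique separates these two
  vertices. Otherwise the union equals one of the parts, and the induction hypothesis for that part
  applies.\<close>

lemma clique_glued_cutset:
  "clique_glued G \<Longrightarrow> cobipartite G \<or> (\<exists>K. clique_cutset G K)"
proof (induction rule: clique_glued.induct)
  case (glue G H)
  let ?K = "pverts G \<inter> pverts H" and ?U = "graph_union G H"
  \<comment> \<open>A part contained in the other is the gluing clique itself, so all its arcs are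
    already present in the other part.\<close>
  have union_absorb: "graph_union G' H' = H'"
    if "clique_glued G'" "pverts G' \<subseteq> pverts H'" "is_clique H' (pverts G' \<inter> pverts H')"
    for G' H' :: "'a pair_pre_digraph"
  proof -
    have "parcs G' \<subseteq> parcs H'"
      using that clique_glued_arcs[OF that(1)] unfolding is_clique_def
      by (metis Int_absorb2 subrelI)
    then show ?thesis
      using that by (auto intro!: pair_pre_digraph.equality)
  qed
  have comm: "graph_union H G = graph_union G H"
    by (auto simp: graph_union_def)
  consider "pverts G \<subseteq> pverts H" | "pverts H \<subseteq> pverts G"
    | u v where "u \<in> pverts G - pverts H" "v \<in> pverts H - pverts G"
    by blast
  then show ?case
  proof cases
    case 1
    then show ?thesis
      using union_absorb[OF glue.hyps(1)] glue.IH(2) glue.hyps by metis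
  next
    case 2
    then show ?thesis
      using union_absorb[OF glue.hyps(2)] glue.IH(1) glue.hyps comm by (metis inf_commute)
  next
    case 3
    have "parcs G \<subseteq> pverts G \<times> pverts G" "parcs H \<subseteq> pverts H \<times> pverts H"
      using glue.hyps(1,2) clique_glued_pair_graph pair_graph_iff by blast+
    with 3 have "\<not> connected (with_proj ?U \<restriction> (pverts ?U - ?K))"
      by (intro not_connected_if_separated[of u "pverts G - pverts H" _ v]) auto
    moreover have "is_clique ?U ?K" "pverts ?U - ?K \<noteq> {}"
      using glue.hyps 3 by (auto simp: is_clique_def)
    ultimately show ?thesis
      unfolding clique_cutset_def by blast
  qed
qed auto


section \<open>Perfection\<close>

text \<open>
  Hall's theorem, by the argument of Halmos and Vaughan: either some nonempty proper subfamily is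
  tight and can be split off, or any one representative can be removed from all other sets.
\<close>

lemma hall:
  assumes "finite I" "\<And>i. i \<in> I \<Longrightarrow> finite (C i)"
    and "\<And>J. J \<subseteq> I \<Longrightarrow> card J \<le> card (\<Union>(C ` J))"
  shows "\<exists>f. inj_on f I \<and> (\<forall>i\<in>I. f i \<in> C i)"
  using assms
proof (induction "card I" arbitrary: I C rule: less_induct)
  case less
  show ?case
  proof (cases "\<exists>J. J \<noteq> {} \<and> J \<subset> I \<and> card (\<Union>(C ` J)) = card J")
    case True
    then obtain J where J: "J \<noteq> {}" "J \<subset> I" "card (\<Union>(C ` J)) = card J"
      by blast
    let ?T = "\<Union>(C ` J)" and ?D = "\<lambda>i. C i - \<Union>(C ` J)"
    have fin: "finite J"
      using J(2) less.prems(1) by (auto intro: finite_subset)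
    then have "finite ?T"
      using J(2) less.prems(2) by blast
    note fin = fin this
    have "card J < card I" "card (I - J) < card I"
      using J less.prems(1) fin by (auto intro!: psubset_card_mono)
    have "\<exists>f. inj_on f J \<and> (\<forall>i\<in>J. f i \<in> C i)"
      using \<open>card J < card I\<close> fin J less.prems by (intro less.hyps) auto
    then obtain f where f: "inj_on f J" "\<forall>i\<in>J. f i \<in> C i"
      by blast
    \<comment> \<open>The union over \<open>L \<union> J\<close> has at least
      \<open>card L + card J\<close> elements; as \<open>J\<close> is tight, removing
      \<open>?T\<close> costs exactly \<open>card J\<close> of them.\<close>
    have "card L \<le> card (\<Union>(?D ` L))" if "L \<subseteq> I - J" for L
    proof -
      have "finite L"
        using that less.prems(1) by (auto intro: finite_subset)
      then have finD: "finite (\<Union>(?D ` L))"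
        using that less.prems(2) by auto
      have "card L + card J = card (L \<union> J)"
        using that fin \<open>finite L\<close> by (subst card_Un_disjoint) auto
      also have "\<dots> \<le> card (\<Union>(C ` (L \<union> J)))"
        using that J by (intro less.prems(3)) auto
      also have "\<Union>(C ` (L \<union> J)) = \<Union>(?D ` L) \<union> ?T"
        by auto
      also have "card \<dots> = card (\<Union>(?D ` L)) + card ?T"
        using fin finD by (intro card_Un_disjoint) auto
      finally show ?thesis
        using J(3) by simp
    qed
    then have "\<exists>g. inj_on g (I - J) \<and> (\<forall>i\<in>I - J. g i \<in> ?D i)"
      using \<open>card (I - J) < card I\<close> less.prems by (intro less.hyps) auto
    then obtain g where g: "inj_on g (I - J)" "\<forall>i\<in>I - J. g i \<in> ?D i"
      by blast
    let ?h = "\<lambda>i. if i \<in> J then f i else g i"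
    have "f i \<noteq> g j" if "i \<in> J" "j \<in> I - J" for i j
      using that f g by force
    then have "inj_on ?h I"
      using f(1) g(1) unfolding inj_on_def by (metis Diff_iff)
    moreover have "\<forall>i\<in>I. ?h i \<in> C i"
      using f g by auto
    ultimately show ?thesis
      by (intro exI[of _ ?h]) blast
  next
    case False
    show ?thesis
    proof (cases "I = {}")
      case False
      then obtain i where i: "i \<in> I"
        by blast
      have "card {i} \<le> card (\<Union>(C ` {i}))"
        using i by (intro less.prems(3)) auto
      then obtain x where x: "x \<in> C i"
        by fastforce
      \<comment> \<open>No nonempty proper subfamily is tight here, so a nonempty \<open>L\<close>
        has one element to spare and can lose \<open>x\<close>.\<close>
      have "card L \<le> card (\<Union>j\<in>L. C j - {x})" if L: "L \<subseteq> I - {i}" for L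
      proof (cases "L = {}")
        case False
        have fin: "finite (\<Union>(C ` L))"
          using L less.prems by (auto intro: finite_subset)
        have "card L \<le> card (\<Union>(C ` L))" "card (\<Union>(C ` L)) \<noteq> card L"
          using L i False \<open>\<not> (\<exists>J. J \<noteq> {} \<and> J \<subset> I \<and> card (\<Union>(C ` J)) = card J)\<close> less.prems(3)[of L]
          by blast+
        then have "card L \<le> card (\<Union>(C ` L)) - 1"
          by linarith
        also have "\<dots> \<le> card (\<Union>(C ` L) - {x})"
          using fin by (simp add: card_Diff_singleton_if)
        also have "\<Union>(C ` L) - {x} = (\<Union>j\<in>L. C j - {x})"
          by auto
        finally show ?thesis .
      qed simp
      moreover have "card (I - {i}) < card I"
        using i less.prems(1) by (rule card_Diff1_less[rotated])
      ultimately have "\<exists>g. inj_on g (I - {i}) \<and> (\<forall>j\<in>I - {i}. g j \<in> C j - {x})"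
        using less.prems by (intro less.hyps) auto
      then obtain g where g: "inj_on g (I - {i})" "\<forall>j\<in>I - {i}. g j \<in> C j - {x}"
        by blast
      then have "inj_on (g(i := x)) I" "\<forall>j\<in>I. (g(i := x)) j \<in> C j"
        using x by (auto simp: inj_on_def)
      then show ?thesis
        by blast
    qed simp
  qed
qed

section \<open>Optimal colorings, first of cobipartite graphs and then of glued ones\<close>

text \<open>The clique \<open>B\<close> takes the colors from 1 to \<open>card B\<close>. A vertex
  of \<open>A\<close> may reuse the color of a non-neighbour in \<open>B\<close> or take a color
  above \<open>card B\<close>, and Hall's theorem selects distinct ones. Hall's condition holds
  because a nonempty \<open>J \<subseteq> A\<close> and its common neighbours in \<open>B\<close>
  form a clique, of size at most \<open>m\<close>, and only the colors of these common neighbours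
  are missing from the union of the lists of \<open>J\<close>.\<close>

lemma cobipartite_proper_coloring:
  assumes G: "pair_graph G" "cobipartite G"
    and m: "\<And>K. is_clique G K \<Longrightarrow> card K \<le> m"
  shows "\<exists>\<phi>. proper_coloring G m \<phi>"
proof -
  obtain A B where AB: "A \<union> B = pverts G" "A \<inter> B = {}" "is_clique G A" "is_clique G B"
    using G(2) unfolding cobipartite_iff by blast
  have fin: "finite A" "finite B"
    using G(1) AB(1) unfolding pair_graph_iff by (metis finite_Un)+
  have sym: "(v, u) \<in> parcs G" if "(u, v) \<in> parcs G" for u v
    using G(1) that unfolding pair_graph_iff by (meson symD)
  have Bm: "card B \<le> m"
    using m AB by blast
  obtain e where e: "bij_betw e B {1..card B}"
    using fin(2) finite_same_card_bij[of B "{1..card B}"] by auto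
  then have e_range: "1 \<le> e b \<and> e b \<le> card B" if "b \<in> B" for b
    using that bij_betw_apply by fastforce
  define C where "C a = e ` {b \<in> B. (a, b) \<notin> parcs G} \<union> {card B<..m}" for a
  have "\<exists>f. inj_on f A \<and> (\<forall>a\<in>A. f a \<in> C a)"
  proof (rule hall)
    fix J assume J: "J \<subseteq> A"
    show "card J \<le> card (\<Union>(C ` J))"
    proof (cases "J = {}")
      case False
      let ?N = "{b \<in> B. \<forall>a\<in>J. (a, b) \<in> parcs G}"
      have "(u, v) \<in> parcs G"
        if "u \<in> A \<and> v \<in> A \<or> u \<in> B \<and> v \<in> B" "u \<noteq> v" for u v
        using that AB(3,4) unfolding is_clique_def by blast
      then have "(u, v) \<in> parcs G" if "u \<in> J \<union> ?N" "v \<in> J \<union> ?N" "u \<noteq> v" for u v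
        using that J sym by (elim UnE) auto
      moreover have "J \<union> ?N \<subseteq> pverts G"
        using J AB(1) by blast
      ultimately have "is_clique G (J \<union> ?N)"
        unfolding is_clique_def by blast
      then have "card (J \<union> ?N) \<le> m"
        by (rule m)
      moreover have "card (J \<union> ?N) = card J + card ?N"
        using J AB(2) fin by (intro card_Un_disjoint) (auto intro: finite_subset)
      moreover have "card (e ` (B - ?N)) = card B - card ?N"
        using e fin by (subst card_image)
          (auto simp: bij_betw_def card_Diff_subset intro: inj_on_subset)
      moreover have "card ?N \<le> card B"
        using fin by (intro card_mono) auto
      moreover have "\<Union>(C ` J) = e ` (B - ?N) \<union> {card B<..m}"
        using False by (auto simp: C_def)
      moreover have "card (e ` (B - ?N) \<union> {card B<..m}) = card (e ` (B - ?N)) + card {card B<..m}"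
        using fin by (intro card_Un_disjoint) (auto dest!: e_range)
      ultimately show ?thesis
        using Bm by simp
    qed simp
  qed (use fin in \<open>auto simp: C_def\<close>)
  then obtain f where f: "inj_on f A" "\<forall>a\<in>A. f a \<in> C a"
    by blast
  define \<phi> where "\<phi> v = (if v \<in> B then e v else f v)" for v
  have "\<phi> v \<in> {1..m}" if "v \<in> pverts G" for v
  proof (cases "v \<in> B")
    case True
    then show ?thesis
      using e_range[of v] Bm by (auto simp: \<phi>_def)
  next
    case False
    then have "f v \<in> C v"
      using that f AB by blast
    then show ?thesis
      using False e_range Bm by (force simp: \<phi>_def C_def)
  qed
  moreover have "\<phi> u \<noteq> \<phi> v" if uv: "(u, v) \<in> parcs G" for u v
  proof -
    have sep: "f a \<noteq> e b" if "a \<in> A" "b \<in> B" "(a, b) \<in> parcs G" for a b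
    proof
      assume "f a = e b"
      with that f(2) have "e b \<in> C a"
        by force
      moreover have "e b \<le> card B"
        using e_range that by blast
      ultimately obtain b' where "b' \<in> B" "(a, b') \<notin> parcs G" "e b' = e b"
        unfolding C_def by auto
      with e that show False
        unfolding bij_betw_def by (metis inj_onD)
    qed
    have "u \<in> A \<union> B" "v \<in> A \<union> B" "u \<noteq> v"
      using uv G(1) AB(1) unfolding pair_graph_iff by (auto simp: irrefl_def)
    then show ?thesis
      using sep[OF _ _ uv] sep[OF _ _ sym[OF uv]] f(1) e AB(2)
      unfolding \<phi>_def bij_betw_def by (auto dest: inj_onD)
  qed
  ultimately show ?thesis
    unfolding proper_coloring_def by (intro exI[of _ \<phi>]) auto
qed

text \<open>The partial map sending \<open>g x\<close> to \<open>f x\<close> is a bijection between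
  two subsets of \<open>S\<close>. Their complements in \<open>S\<close> have equal size, so any
  bijection between these completes it.\<close>

lemma permutation_matching_injections:
  assumes "finite S" "inj_on f K" "inj_on g K" "f ` K \<subseteq> S" "g ` K \<subseteq> S"
  obtains p where "bij_betw p S S" "\<And>x. x \<in> K \<Longrightarrow> p (g x) = f x"
proof -
  have "card (S - g ` K) = card (S - f ` K)"
    using assms by (simp add: card_Diff_subset finite_subset card_image)
  then obtain q where q: "bij_betw q (S - g ` K) (S - f ` K)"
    using assms(1) finite_same_card_bij[of "S - g ` K" "S - f ` K"] by auto
  define p where "p y = (if y \<in> g ` K then f (the_inv_into K g y) else q y)" for y
  have pg: "p (g x) = f x" if "x \<in> K" for x
    using that assms(3) by (simp add: p_def the_inv_into_f_f)
  have "inj_on p (g ` K)"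
    using pg assms(2) by (auto simp: inj_on_def)
  moreover have "p ` g ` K = f ` K"
    using pg by (force simp: image_iff)
  ultimately have "bij_betw p (g ` K) (f ` K)"
    by (simp add: bij_betw_def)
  moreover have "bij_betw p (S - g ` K) (S - f ` K)"
    using q by (rule bij_betw_cong[THEN iffD1, rotated]) (auto simp: p_def)
  ultimately have "bij_betw p (g ` K \<union> (S - g ` K)) (f ` K \<union> (S - f ` K))"
    by (rule bij_betw_combine) auto
  then have "bij_betw p S S"
    using assms(4,5) by (simp add: Un_absorb1)
  with pg that show thesis
    by blast
qed

lemma proper_coloring_inj_on_clique:
  "proper_coloring G k \<phi> \<Longrightarrow> is_clique G K \<Longrightarrow> inj_on \<phi> K"
  unfolding proper_coloring_def is_clique_def inj_on_def by blast

text \<open>Here \<open>m\<close> is any bound on the clique sizes, so both parts of a gluing are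
  colored from one palette. Each coloring is injective on the gluing clique, so permuting the colors
  of the second makes it agree with the first there.\<close>

lemma clique_glued_proper_coloring:
  "clique_glued G \<Longrightarrow> (\<And>K. is_clique G K \<Longrightarrow> card K \<le> m) \<Longrightarrow> \<exists>\<phi>. proper_coloring G m \<phi>"
proof (induction rule: clique_glued.induct)
  case (cobipartite G)
  then show ?case
    using cobipartite_proper_coloring by blast
next
  case (glue G H)
  let ?K = "pverts G \<inter> pverts H"
  have "is_clique (graph_union G H) K" if "is_clique G K \<or> is_clique H K" for K
    using that unfolding is_clique_def by auto
  with glue obtain \<phi> \<psi> where \<phi>: "proper_coloring G m \<phi>" and \<psi>: "proper_coloring H m \<psi>"
    by meson
  have inj: "inj_on \<phi> ?K" "inj_on \<psi> ?K"
    using glue.hyps(3,4) \<phi> \<psi> proper_coloring_inj_on_clique by blast+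
  have ran: "\<phi> ` ?K \<subseteq> {1..m}" "\<psi> ` ?K \<subseteq> {1..m}"
    using \<phi> \<psi> unfolding proper_coloring_def by blast+
  obtain p where p: "bij_betw p {1..m} {1..m}" "\<And>x. x \<in> ?K \<Longrightarrow> p (\<psi> x) = \<phi> x"
    using permutation_matching_injections[OF finite_atLeastAtMost inj ran] by blast
  define \<chi> where "\<chi> v = (if v \<in> pverts G then \<phi> v else p (\<psi> v))" for v
  have \<chi>H: "\<chi> v = p (\<psi> v)" if "v \<in> pverts H" for v
    using that p(2) by (auto simp: \<chi>_def)
  have \<psi>_range: "\<psi> v \<in> {1..m}" if "v \<in> pverts H" for v
    using that \<psi> unfolding proper_coloring_def by blast
  have "\<chi> v \<in> {1..m}" if "v \<in> pverts G \<union> pverts H" for v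
  proof (cases "v \<in> pverts G")
    case True
    then show ?thesis
      using \<phi> unfolding \<chi>_def proper_coloring_def by auto
  next
    case False
    with that have "p (\<psi> v) \<in> {1..m}"
      using \<psi>_range[of v] p(1) by (intro bij_betw_apply[OF p(1)]) auto
    with False show ?thesis
      by (simp add: \<chi>_def)
  qed
  moreover have "\<chi> u \<noteq> \<chi> v" if "(u, v) \<in> parcs G" for u v
    using that \<phi> clique_glued_arcs[OF glue.hyps(1) that]
    unfolding \<chi>_def proper_coloring_def by auto
  moreover have "\<chi> u \<noteq> \<chi> v" if "(u, v) \<in> parcs H" for u v
  proof -
    have "\<psi> u \<noteq> \<psi> v" "u \<in> pverts H" "v \<in> pverts H"
      using that \<psi> clique_glued_arcs[OF glue.hyps(2) that] unfolding proper_coloring_def by auto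
    then show ?thesis
      using p(1) \<psi>_range \<chi>H unfolding bij_betw_def by (metis inj_onD)
  qed
  ultimately have "proper_coloring (graph_union G H) m \<chi>"
    unfolding proper_coloring_def by auto
  then show ?case
    by blast
qed

lemma clique_glued_chromatic_number:
  assumes "clique_glued G"
  shows "chromatic_number G = clique_number G"
proof -
  let ?\<C> = "{K. is_clique G K}"
  have "?\<C> \<subseteq> Pow (pverts G)"
    by (auto simp: is_clique_def)
  then have fin: "finite (card ` ?\<C>)"
    using clique_glued_finite[OF assms] by (meson finite_Pow_iff finite_imageI finite_subset)
  have "is_clique G {}"
    by (simp add: is_clique_def)
  then have "clique_number G \<in> card ` ?\<C>"
    unfolding clique_number_def using fin by (intro Max_in) auto
  then obtain K where K: "is_clique G K" "card K = clique_number G"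
    by auto
  have "\<exists>\<phi>. proper_coloring G (clique_number G) \<phi>"
    using assms fin by (intro clique_glued_proper_coloring) (auto simp: clique_number_def)
  moreover have "clique_number G \<le> k" if "proper_coloring G k \<phi>" for k \<phi>
  proof -
    have "inj_on \<phi> K" "\<phi> ` K \<subseteq> {1..k}"
      using that K(1) proper_coloring_inj_on_clique unfolding is_clique_def proper_coloring_def
      by blast+
    then show ?thesis
      using K(2) card_inj_on_le[of \<phi> K "{1..k}"] by simp
  qed
  ultimately show ?thesis
    unfolding chromatic_number_def by (intro Least_equality) auto
qed

lemma clique_glued_perfect: "clique_glued G \<Longrightarrow> perfect_graph G"
  unfolding perfect_graph_def
  by (metis clique_glued_chromatic_number clique_glued_induce is_induced_subgraphD(1))

section \<open>Clique-colorings\<close>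

lemma maximal_cliqueD_insert:
  assumes "maximal_clique G M" "x \<in> pverts G" "sym (parcs G)"
    and "\<And>y. y \<in> M \<Longrightarrow> x \<noteq> y \<Longrightarrow> (x, y) \<in> parcs G"
  shows "x \<in> M"
proof -
  have "is_clique G (insert x M)"
    using assms unfolding maximal_clique_def is_clique_def by (auto dest: symD)
  then show ?thesis
    using assms(1) unfolding maximal_clique_def by blast
qed

text \<open>Two colors distinguish a set \<open>S\<close> from its complement. If a vertex
  \<open>v\<close> has a neighbour on the other side, or the other side is empty, \<open>S\<close>
  is the neighbourhood of \<open>v\<close>. If no edge joins two nonempty sides, every maximal
  clique is a side, and \<open>S\<close> takes one vertex of each.\<close>

lemma cobipartite_2_clique_colorable:
  assumes "pair_graph G" "cobipartite G"
  shows "clique_colorable 2 G"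
proof -
  obtain A B where AB: "A \<union> B = pverts G" "A \<inter> B = {}" "is_clique G A" "is_clique G B"
    using assms(2) unfolding cobipartite_iff by blast
  have sym: "sym (parcs G)"
    using assms(1) unfolding pair_graph_iff by blast
  have colorable: "clique_colorable 2 G"
    if "\<And>M. maximal_clique G M \<Longrightarrow> card M \<ge> 2 \<Longrightarrow> \<not> M \<subseteq> S \<and> \<not> M \<inter> S = {}" for S
  proof -
    have "M \<subseteq> S \<or> M \<inter> S = {}" if "monochromatic (\<lambda>v. if v \<in> S then 1 else 2) M" for M
    proof -
      from that obtain c :: nat where "\<forall>v\<in>M. (if v \<in> S then 1 else 2) = c"
        unfolding monochromatic_def by blast
      then show ?thesis
        by (cases "c = 1") (auto split: if_splits)
    qed
    with that have "clique_coloring G 2 (\<lambda>v. if v \<in> S then 1 else 2)"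
      unfolding clique_coloring_def by auto
    then show ?thesis
      unfolding clique_colorable_def by blast
  qed
  have local: "clique_colorable 2 G"
    if v: "v \<in> A'" "A' \<union> B' = pverts G" "A' \<inter> B' = {}" "is_clique G A'" "is_clique G B'"
      and nb: "B' \<noteq> {} \<Longrightarrow> \<exists>b\<in>B'. (v, b) \<in> parcs G" for v A' B'
  proof (rule colorable)
    fix M assume M: "maximal_clique G M" "card M \<ge> 2"
    let ?S = "{u. (v, u) \<in> parcs G}"
    have cl: "is_clique G M"
      using M unfolding maximal_clique_def by blast
    have "\<not> M \<subseteq> ?S"
    proof
      assume sub: "M \<subseteq> ?S"
      \<comment> \<open>By maximality a vertex adjacent to all of \<open>M\<close> belongs to
        \<open>M\<close>, but \<open>v\<close> is not its own neighbour.\<close>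
      have "v \<in> M"
        using M(1) sym v sub by (intro maximal_cliqueD_insert[of G M v]) auto
      with sub have "(v, v) \<in> parcs G"
        by blast
      then show False
        using assms(1) unfolding pair_graph_iff irrefl_def by blast
    qed
    moreover have "M \<inter> ?S \<noteq> {}"
    proof
      assume dis: "M \<inter> ?S = {}"
      \<comment> \<open>A clique with two vertices that avoids the neighbourhood of \<open>v\<close>
        cannot contain \<open>v\<close>, so it lies in \<open>B'\<close>; by maximality it then
        contains the neighbour of \<open>v\<close> in \<open>B'\<close>.\<close>
      have "v \<notin> M"
      proof
        assume "v \<in> M"
        then have "(v, u) \<in> parcs G" if "u \<in> M" "u \<noteq> v" for u
          using that cl unfolding is_clique_def by metis
        then have "M \<subseteq> {v}"
          using dis by blast
        then show False
          using M(2) card_mono[of "{v}" M] by simp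
      qed
      have "(v, u) \<in> parcs G" if "u \<in> A'" "u \<noteq> v" for u
        using that v(1,4) unfolding is_clique_def by metis
      moreover have "M \<subseteq> A' \<union> B'"
        using cl v(2) unfolding is_clique_def by blast
      ultimately have "M \<subseteq> B'"
        using dis \<open>v \<notin> M\<close> by blast
      moreover have "M \<noteq> {}"
        using M(2) by auto
      ultimately obtain b where b: "b \<in> B'" "(v, b) \<in> parcs G"
        using nb by blast
      then have "b \<in> M"
        using M(1) sym \<open>M \<subseteq> B'\<close> v(2,5)
        by (intro maximal_cliqueD_insert[of G M b]) (auto simp: is_clique_def)
      with b dis show False
        by blast
    qed
    ultimately show "\<not> M \<subseteq> ?S \<and> \<not> M \<inter> ?S = {}"
      by blast
  qed
  consider v where "v \<in> A" "B = {}" | v where "v \<in> B" "A = {}"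
    | u v where "u \<in> A" "v \<in> B" "(u, v) \<in> parcs G"
    | u v where "u \<in> A" "v \<in> B" "parcs G \<inter> A \<times> B = {}" | "A = {}" "B = {}"
    by blast
  then show ?thesis
  proof cases
    case 1
    then show ?thesis
      using local[of v A B] AB by blast
  next
    case 2
    then show ?thesis
      using local[of v B A] AB by blast
  next
    case 3
    then show ?thesis
      using local[of u A B] AB by blast
  next
    case 4
    show ?thesis
    proof (rule colorable)
      fix M assume M: "maximal_clique G M" "card M \<ge> 2"
      have cl: "is_clique G M"
        using M unfolding maximal_clique_def by blast
      have "M \<subseteq> A \<or> M \<subseteq> B"
      proof (rule ccontr)
        assume "\<not> (M \<subseteq> A \<or> M \<subseteq> B)"
        moreover have "M \<subseteq> A \<union> B"
          using cl AB(1) unfolding is_clique_def by blast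
        ultimately obtain x y where "x \<in> M" "y \<in> M" "x \<in> A" "y \<in> B"
          by blast
        moreover from this have "x \<noteq> y"
          using AB(2) by blast
        ultimately show False
          using cl 4(3) unfolding is_clique_def by blast
      qed
      then have "M = A \<or> M = B"
        using M(1) AB unfolding maximal_clique_def by metis
      then show "\<not> M \<subseteq> {u, v} \<and> \<not> M \<inter> {u, v} = {}"
      proof
        assume "M = A"
        moreover have "\<not> A \<subseteq> {u}"
          using M(2) card_mono[of "{u}" A] \<open>M = A\<close> by auto
        ultimately show ?thesis
          using 4 AB(2) by blast
      next
        assume "M = B"
        moreover have "\<not> B \<subseteq> {v}"
          using M(2) card_mono[of "{v}" B] \<open>M = B\<close> by auto
        ultimately show ?thesis
          using 4 AB(2) by blast
      qed
    qed
  next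
    \<comment> \<open>\<open>pair_graph\<close> admits the null graph, whose only clique is
      empty.\<close>
    case 5
    then show ?thesis
      using AB by (intro colorable[of "{}"]) (auto simp: maximal_clique_def is_clique_def)
  qed
qed


section \<open>Forcing monochromatic maximal cliques\<close>

lemma maximal_clique_subset: "maximal_clique G M \<Longrightarrow> M \<subseteq> pverts G"
  unfolding maximal_clique_def is_clique_def by blast

lemma is_clique_supergraph:
  "is_clique D K \<Longrightarrow> pverts D \<subseteq> pverts G \<Longrightarrow> parcs D \<subseteq> parcs G \<Longrightarrow> is_clique G K"
  unfolding is_clique_def by blast

text \<open>A vertex of \<open>M\<close> outside \<open>H\<close> has all its arcs in
  \<open>G\<close>, so a clique of the union containing \<open>M\<close> stays inside
  \<open>G\<close>. Its arcs from \<open>H\<close> join vertices of the intersection, which is a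
  clique of \<open>G\<close>.\<close>

lemma maximal_clique_union:
  assumes "pair_graph G" "pair_graph H" "is_clique G (pverts G \<inter> pverts H)"
    and M: "maximal_clique G M" "\<not> M \<subseteq> pverts H"
  shows "maximal_clique (graph_union G H) M"
  unfolding maximal_clique_def
proof (intro conjI allI impI)
  have cl: "is_clique G M"
    using M unfolding maximal_clique_def by blast
  then show "is_clique (graph_union G H) M"
    unfolding is_clique_def by auto
  fix L assume L: "is_clique (graph_union G H) L \<and> M \<subseteq> L"
  obtain x where x: "x \<in> M" "x \<notin> pverts H" "x \<in> pverts G"
    using M(2) cl unfolding is_clique_def by blast
  have H: "u \<in> pverts H" "v \<in> pverts H" if "(u, v) \<in> parcs H" for u v
    using that assms(2) unfolding pair_graph_iff by blast+
  have L_arc: "(u, v) \<in> parcs G \<or> (u, v) \<in> parcs H" if "u \<in> L" "v \<in> L" "u \<noteq> v" for u v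
    using that L unfolding is_clique_def by auto
  have "L \<subseteq> pverts G"
  proof
    fix y assume "y \<in> L"
    show "y \<in> pverts G"
    proof (cases "y = x")
      case False
      then have "(x, y) \<in> parcs G"
        using L_arc[of x y] H x L \<open>y \<in> L\<close> by blast
      then show ?thesis
        using assms(1) unfolding pair_graph_iff by blast
    qed (use x in simp)
  qed
  then have "is_clique G L"
    using L_arc H assms(3) unfolding is_clique_def by blast
  then show "L = M"
    using M(1) L unfolding maximal_clique_def by blast
qed

lemma graph_union_commute: "graph_union G H = graph_union H G"
  by (auto simp: graph_union_def)

text \<open>
  The set \<open>\<Union>i<k. Q i\<close> is the clique along which \<open>G\<close> is glued to other graphs, whose vertices are
  listed in \<open>X\<close>; a maximal clique that is not contained in it survives the gluing.  For \<open>k > d\<close> there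
  is no injective choice of colors, so the condition on the colorings is vacuous.
\<close>

definition forcing :: "nat \<Rightarrow> nat \<Rightarrow> nat \<Rightarrow> bool" where
  "forcing d k n \<longleftrightarrow>
     (\<forall>(Q :: nat \<Rightarrow> nat set) X.
        finite X \<and> (\<forall>i<k. finite (Q i) \<and> card (Q i) = n) \<and> disjoint_family_on Q {..<k} \<longrightarrow>
        (\<exists>G. clique_glued G \<and> is_clique G (\<Union>i<k. Q i) \<and> pverts G \<inter> X \<subseteq> (\<Union>i<k. Q i) \<and>
           (\<forall>\<phi> c. \<phi> ` pverts G \<subseteq> {1..d} \<and> inj_on c {..<k} \<and> (\<forall>i<k. \<forall>v\<in>Q i. \<phi> v = c i) \<longrightarrow>
              (\<exists>M. maximal_clique G M \<and> card M \<ge> 2 \<and> monochromatic \<phi> M \<and> \<not> M \<subseteq> (\<Union>i<k. Q i)))))"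

text \<open>One forcing graph is glued on for each \<open>Q \<in> \<F>\<close>. The monochromatic
  cliques are required to leave \<open>D\<close>: later gluings take place along cliques of
  \<open>D\<close>, so such cliques stay maximal.\<close>

lemma forcing_attach:
  fixes D :: "nat pair_pre_digraph" and \<F> :: "(nat \<Rightarrow> nat set) set"
  assumes forcing: "forcing d k n" and D: "clique_glued D" and X: "finite X" and "finite \<F>"
    and "\<forall>Q\<in>\<F>.
      is_clique D (\<Union>i<k. Q i) \<and> (\<forall>i<k. card (Q i) = n) \<and> disjoint_family_on Q {..<k}"
  shows "\<exists>G. clique_glued G \<and> pverts D \<subseteq> pverts G \<and> parcs D \<subseteq> parcs G \<and>
    pverts G \<inter> X \<subseteq> pverts D \<and>
    (\<forall>M. maximal_clique D M \<and> (\<forall>Q\<in>\<F>. \<not> M \<subseteq> (\<Union>i<k. Q i)) \<longrightarrow> maximal_clique G M) \<and>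
    (\<forall>\<phi> c Q. Q \<in> \<F> \<and> \<phi> ` pverts G \<subseteq> {1..d} \<and> inj_on c {..<k} \<and> (\<forall>i<k. \<forall>v\<in>Q i. \<phi> v = c i) \<longrightarrow>
       (\<exists>M. maximal_clique G M \<and> card M \<ge> 2 \<and> monochromatic \<phi> M \<and> \<not> M \<subseteq> pverts D))"
  using assms(4,5)
proof (induction \<F>)
  case empty
  show ?case
    using D by (intro exI[of _ D]) auto
next
  case (insert Q \<F>)
  let ?Q = "\<Union>i<k. Q i"
  obtain G where G: "clique_glued G" "pverts D \<subseteq> pverts G" "parcs D \<subseteq> parcs G"
      "pverts G \<inter> X \<subseteq> pverts D"
    and G_max: "\<And>M. maximal_clique D M \<Longrightarrow> \<forall>Q\<in>\<F>. \<not> M \<subseteq> (\<Union>i<k. Q i) \<Longrightarrow> maximal_clique G M"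
    and G_mono: "\<And>\<phi> c Q. Q \<in> \<F> \<Longrightarrow> \<phi> ` pverts G \<subseteq> {1..d} \<Longrightarrow> inj_on c {..<k} \<Longrightarrow>
      \<forall>i<k. \<forall>v\<in>Q i. \<phi> v = c i \<Longrightarrow>
      \<exists>M. maximal_clique G M \<and> card M \<ge> 2 \<and> monochromatic \<phi> M \<and> \<not> M \<subseteq> pverts D"
    using insert.IH insert.prems by (smt (verit) insertCI)
  have Q: "is_clique D ?Q" "\<forall>i<k. card (Q i) = n" "disjoint_family_on Q {..<k}"
    using insert.prems by blast+
  have QD: "?Q \<subseteq> pverts D"
    using Q(1) unfolding is_clique_def by blast
  have "finite (Q i)" if "i < k" for i
    using that QD clique_glued_finite[OF D] by (meson UN_subset_iff finite_subset lessThan_iff)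
  \<comment> \<open>Taking \<open>X \<union> pverts G\<close> as the set to avoid makes the new
    graph meet \<open>G\<close> in \<open>?Q\<close> only.\<close>
  then have "\<exists>H. clique_glued H \<and> is_clique H ?Q \<and> pverts H \<inter> (X \<union> pverts G) \<subseteq> ?Q \<and>
      (\<forall>\<phi> c. \<phi> ` pverts H \<subseteq> {1..d} \<and> inj_on c {..<k} \<and> (\<forall>i<k. \<forall>v\<in>Q i. \<phi> v = c i) \<longrightarrow>
        (\<exists>M. maximal_clique H M \<and> card M \<ge> 2 \<and> monochromatic \<phi> M \<and> \<not> M \<subseteq> ?Q))"
    using Q clique_glued_finite[OF G(1)] X
    by (intro forcing[unfolded forcing_def, rule_format]) auto
  then obtain H where H: "clique_glued H" "is_clique H ?Q" "pverts H \<inter> (X \<union> pverts G) \<subseteq> ?Q"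
    and H_mono:
      "\<forall>\<phi> c. \<phi> ` pverts H \<subseteq> {1..d} \<and> inj_on c {..<k} \<and> (\<forall>i<k. \<forall>v\<in>Q i. \<phi> v = c i) \<longrightarrow>
        (\<exists>M. maximal_clique H M \<and> card M \<ge> 2 \<and> monochromatic \<phi> M \<and> \<not> M \<subseteq> ?Q)"
    by (elim exE conjE)
  let ?U = "graph_union G H"
  have "?Q \<subseteq> pverts H"
    using H(2) unfolding is_clique_def by blast
  then have int: "pverts G \<inter> pverts H = ?Q"
    using H(3) QD G(2) by blast
  have clG: "is_clique G ?Q"
    using Q(1) G(2,3) by (rule is_clique_supergraph)
  have U: "clique_glued ?U"
    using clique_glued.glue[OF G(1) H(1)] clG H(2) int by simp
  have maxG: "maximal_clique ?U M" if "maximal_clique G M" "\<not> M \<subseteq> ?Q" for M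
  proof (rule maximal_clique_union)
    show "\<not> M \<subseteq> pverts H"
      using that int maximal_clique_subset by (metis Int_greatest)
  qed (use that clG int G(1) H(1) clique_glued_pair_graph in auto)
  have maxH: "maximal_clique ?U M" if "maximal_clique H M" "\<not> M \<subseteq> ?Q" for M
    unfolding graph_union_commute[of G]
  proof (rule maximal_clique_union)
    show "\<not> M \<subseteq> pverts G"
      using that int maximal_clique_subset by (metis Int_greatest)
  qed (use that H(1,2) int G(1) clique_glued_pair_graph in \<open>auto simp: Int_commute\<close>)
  show ?case
  proof (intro exI[of _ ?U] conjI allI impI)
    show "pverts ?U \<inter> X \<subseteq> pverts D"
      using G(4) H(3) QD by auto
    show "maximal_clique ?U M"
      if "maximal_clique D M \<and> (\<forall>Q\<in>insert Q \<F>. \<not> M \<subseteq> (\<Union>i<k. Q i))" for M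
      using that by (intro maxG G_max) auto
    show "\<exists>M. maximal_clique ?U M \<and> card M \<ge> 2 \<and> monochromatic \<phi> M \<and> \<not> M \<subseteq> pverts D"
      if *: "Q' \<in> insert Q \<F> \<and> \<phi> ` pverts ?U \<subseteq> {1..d} \<and> inj_on c {..<k} \<and>
        (\<forall>i<k. \<forall>v\<in>Q' i. \<phi> v = c i)" for \<phi> c Q'
    proof (cases "Q' = Q")
      case True
      have "\<exists>M. maximal_clique H M \<and> card M \<ge> 2 \<and> monochromatic \<phi> M \<and> \<not> M \<subseteq> ?Q"
        using * True by (intro H_mono[rule_format, of \<phi> c]) auto
      then obtain M where M: "maximal_clique H M" "card M \<ge> 2" "monochromatic \<phi> M" "\<not> M \<subseteq> ?Q"
        by blast
      have "\<not> M \<subseteq> pverts D"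
        using M(4) maximal_clique_subset[OF M(1)] int G(2) by (metis Int_greatest subset_trans)
      with M maxH show ?thesis
        by blast
    next
      case False
      have "\<exists>M. maximal_clique G M \<and> card M \<ge> 2 \<and> monochromatic \<phi> M \<and> \<not> M \<subseteq> pverts D"
        using * False by (intro G_mono[of Q' \<phi> c]) auto
      then show ?thesis
        using maxG QD by blast
    qed
  qed (use G U in auto)
qed


section \<open>Sets spread over two rows\<close>

text \<open>For disjoint rows and \<open>i < m\<close> the size \<open>Suc i + (m - i)\<close> does
  not depend on \<open>i\<close>, so none of these sets properly contains another, even across
  indices. Both parts are nonempty, so the two rows, and then the index, can be read off the
  set.\<close>

definition two_row_sets :: "(nat \<Rightarrow> 'a set) \<Rightarrow> nat \<Rightarrow> nat \<Rightarrow> nat \<Rightarrow> 'a set set" where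
  "two_row_sets R d m i = {I \<union> J | I J.
     \<exists>r r'. r < r' \<and> r' \<le> d \<and> I \<subseteq> R r \<and> J \<subseteq> R r' \<and> card I = Suc i \<and> card J = m - i}"

lemma two_row_sets_subset: "S \<in> two_row_sets R d m i \<Longrightarrow> S \<subseteq> (\<Union>r\<le>d. R r)"
  unfolding two_row_sets_def by fastforce

lemma two_row_sets_card:
  assumes R: "disjoint_family_on R {..d}" and S: "S \<in> two_row_sets R d m i" and "i < m"
  shows "card S = Suc m"
proof -
  obtain I J r r' where *: "S = I \<union> J" "r < r'" "r' \<le> d" "I \<subseteq> R r" "J \<subseteq> R r'"
      "card I = Suc i" "card J = m - i"
    using S unfolding two_row_sets_def by blast
  have "R r \<inter> R r' = {}"
    using R *(2,3) by (intro disjoint_family_onD[OF R]) auto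
  moreover have "finite I" "finite J"
    using *(6,7) \<open>i < m\<close> by (auto intro: card_ge_0_finite)
  ultimately have "card S = card I + card J"
    using * by (subst *(1), intro card_Un_disjoint) auto
  then show ?thesis
    using * \<open>i < m\<close> by simp
qed

lemma two_row_sets_index:
  assumes R: "disjoint_family_on R {..d}"
    and S: "S \<in> two_row_sets R d m i" "S \<in> two_row_sets R d m j" and "i < m" "j < m"
  shows "i = j"
proof -
  obtain I J r r' where *: "S = I \<union> J" "r < r'" "r' \<le> d" "I \<subseteq> R r" "J \<subseteq> R r'"
      "card I = Suc i" "card J = m - i"
    using S(1) unfolding two_row_sets_def by blast
  obtain K L s s' where **: "S = K \<union> L" "s < s'" "s' \<le> d" "K \<subseteq> R s" "L \<subseteq> R s'"
      "card K = Suc j" "card L = m - j"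
    using S(2) unfolding two_row_sets_def by blast
  have same: "p = q" if "x \<in> R p" "x \<in> R q" "p \<le> d" "q \<le> d" for p q x
    using that disjoint_family_onD[OF R, of p q] by auto
  have "I \<noteq> {}" "J \<noteq> {}" "K \<noteq> {}" "L \<noteq> {}"
    using * ** assms(4,5) by auto
  then obtain x y z w where "x \<in> I" "y \<in> J" "z \<in> K" "w \<in> L"
    by blast
  then have "x \<in> R r" "y \<in> R r'" "x \<in> R s \<or> x \<in> R s'" "y \<in> R s \<or> y \<in> R s'"
    using * ** by blast+
  then have "r = s \<or> r = s'" "r' = s \<or> r' = s'"
    using same *(2,3) **(2,3) by (meson less_imp_le_nat order_trans)+
  \<comment> \<open>Both pairs of rows are increasing, which excludes all other
    combinations.\<close>
  then have "r = s" "r' = s'"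
    using *(2) **(2) by auto
  have "R r \<inter> R r' = {}"
    using *(2,3) by (intro disjoint_family_onD[OF R]) auto
  then have "I = S \<inter> R r" "K = S \<inter> R r"
    using *(1,4,5) **(1,4,5) \<open>r = s\<close> \<open>r' = s'\<close> by blast+
  then show ?thesis
    using *(6) **(6) by simp
qed

text \<open>With \<open>J \<supseteq> Y\<close> and \<open>i\<close> elements of \<open>M\<close>
  fixed, one last element varies over the rest of \<open>M\<close>, where at least \<open>n\<close>
  choices remain.\<close>

lemma many_two_row_sets:
  assumes "r < r'" "r' \<le> d" "M \<subseteq> R r" "i + n \<le> card M" "finite (R r')"
    and Y: "Y \<subseteq> R r'" "card Y \<le> m - i" "m - i \<le> card (R r')"
    and disj: "R r \<inter> R r' = {}"
  obtains \<T> where "\<T> \<subseteq> two_row_sets R d m i" "card \<T> = n" "\<And>S. S \<in> \<T> \<Longrightarrow> Y \<subseteq> S"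
proof -
  obtain J where J: "Y \<subseteq> J" "J \<subseteq> R r'" "card J = m - i"
    using Y assms(5) by (meson exists_subset_between)
  obtain I where I: "I \<subseteq> M" "card I = i" "finite I"
    using assms(4) by (meson le_add1 obtain_subset_with_card_n order_trans)
  have "n \<le> card (M - I)"
    using I assms(4) by (simp add: card_Diff_subset)
  then obtain T where T: "T \<subseteq> M - I" "card T = n"
    by (meson obtain_subset_with_card_n)
  have "inj_on (\<lambda>x. insert x I \<union> J) T"
  proof (rule inj_onI)
    fix x y assume xy: "x \<in> T" "y \<in> T" "insert x I \<union> J = insert y I \<union> J"
    have "x \<notin> I" "x \<notin> J"
      using xy(1) T(1) J(2) assms(3) disj by blast+
    then show "x = y"
      using xy(3) by blast
  qed
  then have "card ((\<lambda>x. insert x I \<union> J) ` T) = n"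
    using T(2) by (simp add: card_image)
  moreover have "insert x I \<union> J \<in> two_row_sets R d m i" if "x \<in> T" for x
  proof -
    have "insert x I \<subseteq> R r" "card (insert x I) = Suc i"
      using that T(1) I assms(3) by auto
    then show ?thesis
      using J assms(1,2) unfolding two_row_sets_def by blast
  qed
  ultimately show thesis
    using that[of "(\<lambda>x. insert x I \<union> J) ` T"] J(1) by blast
qed

section \<open>Frequent colors\<close>

lemma pigeonhole_color:
  assumes "\<phi> ` R \<subseteq> {1..d :: nat}" "card R > d * t"
  obtains \<gamma> where "\<gamma> \<in> {1..d}" "t < card {b \<in> R. \<phi> b = \<gamma>}"
proof -
  have "\<exists>\<gamma>\<in>{1..d}. t < card {b \<in> R. \<phi> b = \<gamma>}"
  proof (rule ccontr)
    assume "\<not> (\<exists>\<gamma>\<in>{1..d}. t < card {b \<in> R. \<phi> b = \<gamma>})"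
    then have *: "card {b \<in> R. \<phi> b = \<gamma>} \<le> t" if "\<gamma> \<in> {1..d}" for \<gamma>
      using that by (meson not_le)
    have "R = (\<Union>\<gamma>\<in>{1..d}. {b \<in> R. \<phi> b = \<gamma>})"
      using assms(1) by auto
    then have "card R = card (\<Union>\<gamma>\<in>{1..d}. {b \<in> R. \<phi> b = \<gamma>})"
      by simp
    also have "\<dots> \<le> (\<Sum>\<gamma>\<in>{1..d}. card {b \<in> R. \<phi> b = \<gamma>})"
      by (intro card_UN_le) simp
    also have "\<dots> \<le> (\<Sum>\<gamma>\<in>{1..d}. t)"
      using * by (rule sum_mono)
    finally show False
      using assms(2) by simp
  qed
  with that show thesis
    by blast
qed

text \<open>Each of the \<open>d + 1\<close> rows has a frequent color, and there are only
  \<open>d\<close> colors.\<close>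

lemma pigeonhole_two_rows:
  assumes "\<And>r. r \<le> d \<Longrightarrow> \<phi> ` R r \<subseteq> {1..d :: nat}" "\<And>r. r \<le> d \<Longrightarrow> card (R r) > d * t"
  obtains r r' \<gamma> where "r < r'" "r' \<le> d" "\<gamma> \<in> {1..d}"
    "t < card {b \<in> R r. \<phi> b = \<gamma>}" "t < card {b \<in> R r'. \<phi> b = \<gamma>}"
proof -
  have "\<exists>\<gamma>. \<gamma> \<in> {1..d} \<and> t < card {b \<in> R r. \<phi> b = \<gamma>}" if "r \<le> d" for r
    using assms[OF that] pigeonhole_color by metis
  then obtain \<gamma> where \<gamma>: "\<And>r. r \<le> d \<Longrightarrow> \<gamma> r \<in> {1..d} \<and> t < card {b \<in> R r. \<phi> b = \<gamma> r}"
    by metis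
  have "\<gamma> ` {..d} \<subseteq> {1..d}"
    using \<gamma> by blast
  then have "card (\<gamma> ` {..d}) \<le> card {1..d}"
    by (intro card_mono) simp_all
  then have "card (\<gamma> ` {..d}) < card {..d}"
    by simp
  then have "\<not> inj_on \<gamma> {..d}"
    by (rule pigeonhole)
  then obtain p q where pq: "p \<le> d" "q \<le> d" "p \<noteq> q" "\<gamma> p = \<gamma> q"
    unfolding inj_on_def by blast
  note color = \<gamma>[OF pq(1)] \<gamma>[OF pq(2)]
  show thesis
  proof (cases "p < q")
    case True
    show thesis
      by (rule that[OF True pq(2), of "\<gamma> p"]) (use color pq(4) in simp_all)
  next
    case False
    then have "q < p"
      using pq(3) by simp
    then show thesis
      by (rule that[OF _ pq(1), of _ "\<gamma> p"]) (use color pq(4) in simp_all)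
  qed
qed

section \<open>Cobipartite graphs with prescribed neighbourhoods\<close>

definition two_clique_graph :: "'a set \<Rightarrow> 'a set \<Rightarrow> ('a \<Rightarrow> 'a set) \<Rightarrow> 'a pair_pre_digraph" where
  "two_clique_graph A B N = \<lparr> pverts = A \<union> B,
     parcs = {(u, v). u \<noteq> v \<and> (u \<in> A \<and> v \<in> A \<or> u \<in> B \<and> v \<in> B \<or> u \<in> A \<and> v \<in> N u \<or> v \<in> A \<and> u \<in> N v)} \<rparr>"

context
  fixes A B :: "'a set" and N :: "'a \<Rightarrow> 'a set"
  assumes fin: "finite A" "finite B" and disj: "A \<inter> B = {}" and N: "\<And>a. a \<in> A \<Longrightarrow> N a \<subseteq> B"
begin

lemma two_clique_graph_clique:
  assumes "K \<subseteq> A" "Y \<subseteq> B" "\<And>a. a \<in> K \<Longrightarrow> Y \<subseteq> N a"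
  shows "is_clique (two_clique_graph A B N) (K \<union> Y)"
  unfolding is_clique_def
proof (intro conjI ballI impI)
  show "K \<union> Y \<subseteq> pverts (two_clique_graph A B N)"
    using assms(1,2) by (auto simp: two_clique_graph_def)
  fix u v assume "u \<in> K \<union> Y" "v \<in> K \<union> Y" "u \<noteq> v"
  then show "(u, v) \<in> parcs (two_clique_graph A B N)"
    using assms(1,2) assms(3)[of u] assms(3)[of v] by (simp add: two_clique_graph_def) blast
qed

lemma two_clique_graph_glued: "clique_glued (two_clique_graph A B N)"
proof (rule cobipartite)
  show "pair_graph (two_clique_graph A B N)"
    using fin N unfolding pair_graph_iff two_clique_graph_def
    by (auto simp: sym_def irrefl_def)
  have "is_clique (two_clique_graph A B N) A" "is_clique (two_clique_graph A B N) B"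
    using two_clique_graph_clique[of A "{}"] two_clique_graph_clique[of "{}" B] by auto
  then show "cobipartite (two_clique_graph A B N)"
    using disj unfolding cobipartite_iff by (auto simp: two_clique_graph_def)
qed

text \<open>A vertex of \<open>B\<close> outside \<open>N a\<close> is not adjacent to
  \<open>a\<close>, and a vertex \<open>x\<close> of \<open>A\<close> can be added only if
  \<open>N a \<subseteq> N x\<close>.\<close>

lemma two_clique_graph_maximal:
  assumes a: "a \<in> A" "\<And>x. x \<in> A \<Longrightarrow> N a \<subseteq> N x \<Longrightarrow> x = a"
  shows "maximal_clique (two_clique_graph A B N) (insert a (N a))"
  unfolding maximal_clique_def
proof (intro conjI allI impI)
  show "is_clique (two_clique_graph A B N) (insert a (N a))"
    using two_clique_graph_clique[of "{a}" "N a"] a(1) N by simp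
  fix L assume L: "is_clique (two_clique_graph A B N) L \<and> insert a (N a) \<subseteq> L"
  have arc: "x \<in> A \<and> y \<in> A \<or> x \<in> B \<and> y \<in> B \<or> x \<in> A \<and> y \<in> N x \<or> y \<in> A \<and> x \<in> N y"
    if "x \<in> L" "y \<in> L" "x \<noteq> y" for x y
    using that L unfolding is_clique_def two_clique_graph_def by auto
  have "x \<in> insert a (N a)" if x: "x \<in> L" for x
  proof (cases "x \<in> A")
    case True
    have "b \<in> N x" if "b \<in> N a" for b
      using arc[of x b] that L x True N[OF a(1)] disj by blast
    then show ?thesis
      using a(2) True by blast
  next
    case False
    then show ?thesis
      using arc[of a x] x L a(1) disj N by blast
  qed
  with L show "L = insert a (N a)"
    by blast
qed

end

text \<open>
  Each two-row set of index \<open>i\<close> is the set \<open>N a\<close> of new neighbours of some \<open>a \<in> Q i\<close>.  These sets all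
  have the same size and determine their index, so \<open>insert a (N a)\<close> is a maximal clique.  Some color
  \<open>\<gamma>\<close> is frequent in two rows.  If \<open>\<gamma> = c i\<close>, then these rows contain some \<open>N a\<close> with \<open>a \<in> Q i\<close> that is
  colored \<open>\<gamma>\<close> throughout; otherwise \<open>n\<close> vertices of color \<open>\<gamma>\<close> in one row have \<open>n\<close> common neighbours in
  each \<open>Q i\<close>.
\<close>

lemma forcing_step:
  assumes "forcing d (Suc k) n"
  shows "\<exists>n'. forcing d k n'"
proof -
  \<comment> \<open>For \<open>i < k\<close> this \<open>m\<close> gives \<open>i < m\<close> and
    \<open>n \<le> m - i\<close>. More than \<open>t\<close> vertices of one color suffice for
    either part of a two-row set, and also for \<open>i + n\<close> vertices. A row of
    \<open>s\<close> vertices exceeds \<open>d * t\<close>, as the pigeonhole argument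
    requires.\<close>
  define m t s where "m = n + k" and "t = m + 1" and "s = Suc (d * t)"
  show ?thesis
  \<comment> \<open>The exponent is the size of the set \<open>B\<close> below, so each
    \<open>Q i\<close> can be indexed by all subsets of \<open>B\<close>.\<close>
  proof (rule exI[of _ "2 ^ (Suc d * s)"], unfold forcing_def, intro allI impI, elim conjE)
    fix Q :: "nat \<Rightarrow> nat set" and X :: "nat set"
    assume X: "finite X" and Q: "\<forall>i<k. finite (Q i) \<and> card (Q i) = 2 ^ (Suc d * s)"
      and Q_disj: "disjoint_family_on Q {..<k}"
    define A where "A = (\<Union>i<k. Q i)"
    have "finite (X \<union> A)"
      using X Q by (auto simp: A_def)
    then obtain x0 where x0: "\<And>x. x \<in> X \<union> A \<Longrightarrow> x < x0"
      by (meson finite_nat_set_iff_bounded)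
    \<comment> \<open>Adding \<open>x0\<close> puts the new vertices above all of
      \<open>X \<union> A\<close>.\<close>
    define e where "e p = x0 + prod_encode p" for p
    have e_inj: "inj e"
      unfolding e_def by (auto simp: inj_def)
    define R where "R r = e ` ({r} \<times> {..<s})" for r
    define B where "B = (\<Union>r\<le>d. R r)"
    have R_card: "card (R r) = s" "finite (R r)" for r
      unfolding R_def by (auto simp: card_image inj_on_subset[OF e_inj])
    have R_disj: "R r \<inter> R r' = {}" if "r \<noteq> r'" for r r'
      unfolding R_def using that e_inj by (auto dest: injD)
    have R_disj': "disjoint_family_on R {..d}"
      using R_disj by (auto simp: disjoint_family_on_def)
    have B: "finite B" "card B = Suc d * s"
      unfolding B_def using R_card R_disj by (auto simp: card_UN_disjoint)
    have B_new: "B \<inter> (X \<union> A) = {}"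
      using x0 unfolding B_def R_def e_def by fastforce
    have A_fin: "finite A"
      using Q by (auto simp: A_def)
    define TR where "TR = two_row_sets R d m"
    have TR: "S \<subseteq> B" "card S = Suc m" if "S \<in> TR i" "i < k" for S i
      using that two_row_sets_subset two_row_sets_card[OF R_disj', of S m i]
      unfolding B_def TR_def m_def by fastforce+
    have "\<exists>g. bij_betw g (Q i) (Pow B)" if "i < k" for i
      using that Q B by (intro finite_same_card_bij) (auto simp: card_Pow)
    then obtain g where g: "\<And>i. i < k \<Longrightarrow> bij_betw (g i) (Q i) (Pow B)"
      by metis
    \<comment> \<open>A vertex \<open>a\<close> of \<open>Q i\<close> whose set \<open>g i a\<close>
      is not in \<open>TR i\<close> gets no neighbour in \<open>B\<close>.\<close>
    define N where "N a = {b. \<exists>i<k. a \<in> Q i \<and> g i a \<in> TR i \<and> b \<in> g i a}" for a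
    have index: "i = j" if "a \<in> Q i" "a \<in> Q j" "i < k" "j < k" for a i j
      using that Q_disj by (auto simp: disjoint_family_on_def)
    have N: "N a = (if g i a \<in> TR i then g i a else {})" if "a \<in> Q i" "i < k" for a i
      using that index by (auto simp: N_def)
    have NB: "N a \<subseteq> B" if "a \<in> A" for a
      using TR(1) by (auto simp: N_def)
    let ?D = "two_clique_graph A B N"
    have AB: "A \<inter> B = {}"
      using B_new by blast
    have D_clique: "is_clique ?D (K \<union> Y)"
      if "K \<subseteq> A" "Y \<subseteq> B" "\<And>a. a \<in> K \<Longrightarrow> Y \<subseteq> N a" for K Y
      by (intro two_clique_graph_clique[OF A_fin B(1) AB NB]) (use that in auto)
    have D_glued: "clique_glued ?D"
      by (rule two_clique_graph_glued[OF A_fin B(1) AB NB])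
    have D_verts: "pverts ?D = A \<union> B"
      by (simp add: two_clique_graph_def)
    have D_maximal: "maximal_clique ?D (insert a (N a))" "N a = S"
      if a: "a \<in> Q i" "i < k" "g i a = S" "S \<in> TR i" for a i S
    proof -
      show "N a = S"
        using N a by simp
      \<comment> \<open>Both neighbourhoods have \<open>Suc m\<close> elements, so the inclusion is
        an equality. The common set determines the index, and the bijection \<open>g i\<close> then
        determines the vertex.\<close>
      have "x = a" if x: "x \<in> A" "N a \<subseteq> N x" for x
      proof -
        obtain j where j: "j < k" "x \<in> Q j"
          using x(1) by (auto simp: A_def)
        have "S \<noteq> {}"
          using TR(2)[OF a(4,2)] by auto
        then have Nx: "g j x \<in> TR j" "N x = g j x"
          using x(2) N[OF j(2,1)] \<open>N a = S\<close> by (auto split: if_splits)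
        then have "S \<subseteq> g j x"
          using x(2) \<open>N a = S\<close> by simp
        moreover have "finite (g j x)"
          using TR(1)[OF Nx(1) j(1)] B(1) by (rule finite_subset)
        ultimately have "S = g j x"
          using TR(2)[OF Nx(1) j(1)] TR(2)[OF a(4,2)] by (simp add: card_subset_eq)
        then have "i = j"
          using two_row_sets_index[OF R_disj', of S m i j] a Nx(1) j(1)
          by (simp add: TR_def m_def)
        moreover have "inj_on (g i) (Q i)"
          using g[OF a(2)] by (rule bij_betw_imp_inj_on)
        ultimately show ?thesis
          using a(1,3) j(2) \<open>S = g j x\<close> by (auto dest: inj_onD)
      qed
      then show "maximal_clique ?D (insert a (N a))"
        using a by (intro two_clique_graph_maximal[OF A_fin B(1) AB NB]) (auto simp: A_def)
    qed
    \<comment> \<open>These are the candidates for the next clique. Extensional functions make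
      \<open>\<F>\<close> finite. With at most \<open>n\<close> vertices in \<open>B\<close>, a
      candidate cannot contain a clique \<open>insert a (N a)\<close> having \<open>Suc m\<close> of
      them, so those cliques stay maximal.\<close>
    define \<F> where "\<F> = {P \<in> {..<Suc k} \<rightarrow>\<^sub>E Pow (A \<union> B). is_clique ?D (\<Union>i<Suc k. P i) \<and>
      (\<forall>i<Suc k. card (P i) = n) \<and> disjoint_family_on P {..<Suc k} \<and>
      card ((\<Union>i<Suc k. P i) \<inter> B) \<le> n}"
    have "finite ({..<Suc k} \<rightarrow>\<^sub>E Pow (A \<union> B))"
      using A_fin B(1) by (intro finite_PiE) simp_all
    then have "finite \<F>"
      unfolding \<F>_def by simp
    have \<F>: "\<forall>P\<in>\<F>. is_clique ?D (\<Union>i<Suc k. P i) \<and> (\<forall>i<Suc k. card (P i) = n) \<and>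
      disjoint_family_on P {..<Suc k}"
      unfolding \<F>_def by blast
    obtain G where G: "clique_glued G" "pverts ?D \<subseteq> pverts G" "parcs ?D \<subseteq> parcs G"
        "pverts G \<inter> X \<subseteq> pverts ?D"
      and G_max: "\<forall>M. maximal_clique ?D M \<and> (\<forall>P\<in>\<F>. \<not> M \<subseteq> (\<Union>i<Suc k. P i)) \<longrightarrow> maximal_clique G M"
      and G_mono: "\<forall>\<phi> c P. P \<in> \<F> \<and> \<phi> ` pverts G \<subseteq> {1..d} \<and> inj_on c {..<Suc k} \<and>
          (\<forall>i<Suc k. \<forall>v\<in>P i. \<phi> v = c i) \<longrightarrow>
        (\<exists>M. maximal_clique G M \<and> card M \<ge> 2 \<and> monochromatic \<phi> M \<and> \<not> M \<subseteq> pverts ?D)"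
      using forcing_attach[OF assms D_glued X \<open>finite \<F>\<close> \<F>] by (elim exE conjE)
    have "is_clique G A"
      using D_clique[of A "{}"] G(2,3) by (auto intro: is_clique_supergraph)
    moreover have "pverts G \<inter> X \<subseteq> A"
      using G(4) B_new D_verts by blast
    moreover have "\<exists>M. maximal_clique G M \<and> card M \<ge> 2 \<and> monochromatic \<phi> M \<and> \<not> M \<subseteq> A"
      if \<phi>: "\<phi> ` pverts G \<subseteq> {1..d}" and c: "inj_on c {..<k}" "\<forall>i<k. \<forall>v\<in>Q i. \<phi> v = c i" for \<phi> c
    proof -
      have "\<phi> ` R r \<subseteq> {1..d}" if "r \<le> d" for r
      proof -
        have "R r \<subseteq> pverts G"
          using that G(2) D_verts by (auto simp: B_def)
        with \<phi> show ?thesis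
          by (meson image_mono subset_trans)
      qed
      then obtain r r' \<gamma> where r: "r < r'" "r' \<le> d" "\<gamma> \<in> {1..d}"
        "t < card {b \<in> R r. \<phi> b = \<gamma>}" "t < card {b \<in> R r'. \<phi> b = \<gamma>}"
      proof (rule pigeonhole_two_rows)
        show "card (R r) > d * t" for r
          by (simp add: R_card s_def)
      qed
      let ?M = "{b \<in> R r. \<phi> b = \<gamma>}" and ?M' = "{b \<in> R r'. \<phi> b = \<gamma>}"
      show ?thesis
      proof (cases "\<gamma> \<in> c ` {..<k}")
        case True
        then obtain i where i: "i < k" "c i = \<gamma>"
          by auto
        have "Suc i \<le> card ?M" "m - i \<le> card ?M'"
          using r i unfolding t_def m_def by auto
        then obtain I J where IJ: "I \<subseteq> ?M" "card I = Suc i" "J \<subseteq> ?M'" "card J = m - i"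
          by (meson obtain_subset_with_card_n)
        have S: "I \<union> J \<in> TR i"
          unfolding TR_def two_row_sets_def
        proof (intro CollectI exI conjI)
          show "I \<subseteq> R r" "J \<subseteq> R r'"
            using IJ by auto
        qed (use IJ r(1,2) in simp_all)
        then have "I \<union> J \<in> g i ` Q i"
          using TR(1)[OF S i(1)] bij_betw_imp_surj_on[OF g[OF i(1)]] by simp
        then obtain a where a: "a \<in> Q i" "g i a = I \<union> J"
          by fastforce
        let ?K = "insert a (I \<union> J)"
        have "maximal_clique ?D ?K"
          using D_maximal[OF a(1) i(1) a(2) S] by simp
        moreover have "\<not> ?K \<subseteq> (\<Union>i<Suc k. P i)" if "P \<in> \<F>" for P
        proof
          assume "?K \<subseteq> (\<Union>i<Suc k. P i)"
          then have "card (I \<union> J) \<le> card ((\<Union>i<Suc k. P i) \<inter> B)"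
            using TR(1)[OF S i(1)] B(1) by (intro card_mono) auto
          also have "\<dots> \<le> n"
            using that unfolding \<F>_def by blast
          finally show False
            using TR(2)[OF S i(1)] unfolding m_def by simp
        qed
        ultimately have "maximal_clique G ?K"
          by (intro G_max[rule_format] conjI ballI)
        moreover have "\<phi> v = \<gamma>" if "v \<in> ?K" for v
          using that IJ(1,3) c(2) a(1) i by auto
        then have "monochromatic \<phi> ?K"
          unfolding monochromatic_def by blast
        moreover have "2 \<le> card ?K"
        proof -
          have "a \<in> A"
            using a(1) i(1) by (auto simp: A_def)
          then have "a \<notin> I \<union> J" "finite (I \<union> J)"
            using TR(1)[OF S i(1)] AB B(1) by (auto intro: finite_subset)
          then show ?thesis
            using TR(2)[OF S i(1)] by simp
        qed
        moreover have "I \<union> J \<noteq> {}"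
          using TR(2)[OF S i(1)] by (metis card.empty nat.distinct(1))
        then have "\<not> ?K \<subseteq> A"
          using TR(1)[OF S i(1)] AB by blast
        ultimately show ?thesis
          by blast
      next
        case False
        \<comment> \<open>\<open>Y\<close> becomes the new color class; \<open>?M\<close> in the
          other row only serves to vary the two-row sets that contain \<open>Y\<close>.\<close>
        have "n \<le> card ?M'"
          using r(5) by (simp add: t_def m_def)
        then obtain Y where Y: "Y \<subseteq> ?M'" "card Y = n"
          by (meson obtain_subset_with_card_n)
        have "\<exists>P. P \<subseteq> Q i \<and> card P = n \<and> (\<forall>a\<in>P. Y \<subseteq> N a)" if i: "i < k" for i
        proof -
          have "card ?M' \<le> card (R r')"
            using R_card by (intro card_mono) auto
          then have "i + n \<le> card ?M" "card Y \<le> m - i" "m - i \<le> card (R r')"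
            using i r(4,5) Y(2) by (simp_all add: t_def m_def)
          moreover have "?M \<subseteq> R r" "Y \<subseteq> R r'" "R r \<inter> R r' = {}"
            using Y(1) R_disj[of r r'] r(1) by auto
          ultimately obtain \<T> where \<T>: "\<T> \<subseteq> TR i" "card \<T> = n" "\<And>S. S \<in> \<T> \<Longrightarrow> Y \<subseteq> S"
            using many_two_row_sets[OF r(1,2), of ?M R i n Y m] R_card(2) unfolding TR_def by blast
          \<comment> \<open>\<open>?h\<close> turns the \<open>n\<close> two-row sets containing
            \<open>Y\<close> into \<open>n\<close> vertices of \<open>Q i\<close> adjacent to all of
            \<open>Y\<close>.\<close>
          let ?h = "inv_into (Q i) (g i)"
          have img: "\<T> \<subseteq> g i ` Q i"
            unfolding bij_betw_imp_surj_on[OF g[OF i]] using \<T>(1) TR(1)[OF _ i] by blast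
          have h: "?h S \<in> Q i" "g i (?h S) = S" if "S \<in> \<T>" for S
          proof -
            have S: "S \<in> g i ` Q i"
              by (rule subsetD[OF img that])
            show "?h S \<in> Q i" "g i (?h S) = S"
              using inv_into_into[OF S] f_inv_into_f[OF S] .
          qed
          then have "?h ` \<T> \<subseteq> Q i"
            by blast
          moreover have "card (?h ` \<T>) = n"
            using card_image[OF inj_on_inv_into[OF img]] \<T>(2) by simp
          moreover have "Y \<subseteq> N (?h S)" if "S \<in> \<T>" for S
            using N[OF h(1)[OF that] i] h(2)[OF that] that \<T>(1,3) by (simp add: subset_iff)
          ultimately show ?thesis
            by blast
        qed
        then have "\<forall>i\<in>{..<k}. \<exists>P. P \<subseteq> Q i \<and> card P = n \<and> (\<forall>a\<in>P. Y \<subseteq> N a)"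
          by simp
        from bchoice[OF this] obtain P
          where "\<forall>i\<in>{..<k}. P i \<subseteq> Q i \<and> card (P i) = n \<and> (\<forall>a\<in>P i. Y \<subseteq> N a)" ..
        then have P: "P i \<subseteq> Q i" "card (P i) = n" "a \<in> P i \<Longrightarrow> Y \<subseteq> N a" if "i < k" for i a
          using that by blast+
        \<comment> \<open>The restriction makes the extended family extensional, as membership in
          \<open>\<F>\<close> demands.\<close>
        define P' where "P' = restrict (P(k := Y)) {..<Suc k}"
        have P'_simps: "P' k = Y" "\<And>i. i < k \<Longrightarrow> P' i = P i"
          by (auto simp: P'_def)
        have PA: "(\<Union>i<k. P i) \<subseteq> A"
          unfolding A_def by (intro UN_mono subset_refl P(1)) simp
        have YB: "Y \<subseteq> B"
          using Y(1) r(2) by (auto simp: B_def)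
        have UP': "(\<Union>i<Suc k. P' i) = (\<Union>i<k. P i) \<union> Y"
          using P'_simps by (auto simp: lessThan_Suc)
        have "P' \<in> {..<Suc k} \<rightarrow>\<^sub>E Pow (A \<union> B)"
          unfolding P'_def restrict_PiE_iff
        proof
          fix i assume "i \<in> {..<Suc k}"
          then consider "i = k" | "i < k"
            by fastforce
          then show "(P(k := Y)) i \<in> Pow (A \<union> B)"
            using PA YB by cases auto
        qed
        moreover have "is_clique ?D (\<Union>i<Suc k. P' i)"
          unfolding UP' using PA YB P(3) by (intro D_clique) blast+
        moreover have "\<forall>i<Suc k. card (P' i) = n"
          using P(2) Y(2) P'_simps by (auto simp: less_Suc_eq)
        moreover have "disjoint_family_on P' {..<Suc k}"
        proof -
          have "P' i \<inter> P' j = {}" if "i < j" "j < Suc k" for i j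
          proof (cases "j = k")
            case True
            have "P i \<subseteq> A"
              using that True PA by blast
            then show ?thesis
              using that True P'_simps YB AB by auto
          next
            case False
            then have "P i \<subseteq> Q i" "P j \<subseteq> Q j" "Q i \<inter> Q j = {}"
              using that P(1) disjoint_family_onD[OF Q_disj, of i j] by simp_all
            then have "P i \<inter> P j = {}"
              by blast
            then show ?thesis
              using that False P'_simps by simp
          qed
          then show ?thesis
            unfolding disjoint_family_on_def by (metis Int_commute lessThan_iff nat_neq_iff)
        qed
        moreover have "card ((\<Union>i<Suc k. P' i) \<inter> B) \<le> n"
        proof -
          have "(\<Union>i<Suc k. P' i) \<inter> B = Y"
            unfolding UP' using PA YB AB by (intro equalityI subsetI) blast+
          then show ?thesis
            using Y(2) by simp
        qed
        ultimately have "P' \<in> \<F>"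
          unfolding \<F>_def by (intro CollectI conjI)
        \<comment> \<open>The color \<open>\<gamma>\<close> is new in this case, so \<open>c\<close>
          stays injective when extended by it.\<close>
        moreover have "inj_on (c(k := \<gamma>)) {..<Suc k}"
        proof -
          have "inj_on (c(k := \<gamma>)) {..<k}"
            using c(1) by (rule inj_on_cong[THEN iffD2, rotated]) simp
          moreover have "(c(k := \<gamma>)) ` {..<k} = c ` {..<k}"
            by (intro image_cong) auto
          moreover have "{..<k} - {k} = {..<k}"
            by simp
          ultimately show ?thesis
            using False unfolding lessThan_Suc inj_on_insert by simp
        qed
        moreover have "\<forall>i<Suc k. \<forall>v\<in>P' i. \<phi> v = (c(k := \<gamma>)) i"
        proof (intro allI impI ballI)
          fix i v assume "i < Suc k" "v \<in> P' i"
          then consider "i = k" "v \<in> Y" | "i < k" "v \<in> P i"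
            using P'_simps by (metis less_Suc_eq)
          then show "\<phi> v = (c(k := \<gamma>)) i"
            using P(1) c(2) Y(1) by cases auto
        qed
        \<comment> \<open>The clique obtained leaves \<open>A \<union> B\<close>, hence in
          particular \<open>A\<close>.\<close>
        ultimately have "\<exists>M. maximal_clique G M \<and> card M \<ge> 2 \<and> monochromatic \<phi> M \<and> \<not> M \<subseteq> pverts ?D"
          using \<phi> by (intro G_mono[rule_format, of P' \<phi> "c(k := \<gamma>)"] conjI)
        then show ?thesis
          using D_verts by blast
      qed
    qed
    ultimately show "\<exists>G. clique_glued G \<and> is_clique G (\<Union>i<k. Q i) \<and> pverts G \<inter> X \<subseteq> (\<Union>i<k. Q i) \<and>
        (\<forall>\<phi> c. \<phi> ` pverts G \<subseteq> {1..d} \<and> inj_on c {..<k} \<and> (\<forall>i<k. \<forall>v\<in>Q i. \<phi> v = c i) \<longrightarrow>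
          (\<exists>M. maximal_clique G M \<and> card M \<ge> 2 \<and> monochromatic \<phi> M \<and> \<not> M \<subseteq> (\<Union>i<k. Q i)))"
      using G(1) unfolding A_def by blast
  qed
qed

section \<open>Unbounded clique-chromatic number\<close>

text \<open>The number of classes descends from \<open>Suc d\<close> to 0 by
  \<open>forcing_step\<close>; the induction variable \<open>j\<close> counts the steps.\<close>

lemma forcing_zero: "\<exists>n. forcing d 0 n"
proof -
  have "\<exists>n. forcing d (Suc d - j) n" if "j \<le> Suc d" for j
    using that
  proof (induction j)
    case 0
    \<comment> \<open>With \<open>n = 1\<close> no \<open>Q i\<close> is empty, so every
      \<open>c i\<close> is one of the \<open>d\<close> colors and \<open>c\<close> cannot be
      injective. A complete graph on the given vertices therefore suffices.\<close>
    have "forcing d (Suc d) 1"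
      unfolding forcing_def
    proof (intro allI impI, elim conjE)
      fix Q :: "nat \<Rightarrow> nat set" and X :: "nat set"
      assume Q: "\<forall>i<Suc d. finite (Q i) \<and> card (Q i) = 1"
      let ?A = "\<Union>i<Suc d. Q i"
      let ?G = "two_clique_graph ?A {} (\<lambda>_. {})"
      have "finite ?A"
        using Q by blast
      then have "clique_glued ?G" "is_clique ?G ?A"
        using two_clique_graph_glued[of ?A "{}" "\<lambda>_. {}"]
          two_clique_graph_clique[of ?A "{}" "\<lambda>_. {}" ?A "{}"] by auto
      moreover have "pverts ?G = ?A"
        by (simp add: two_clique_graph_def)
      moreover have False
        if "\<phi> ` ?A \<subseteq> {1..d}" "inj_on c {..<Suc d}" "\<forall>i<Suc d. \<forall>v\<in>Q i. \<phi> v = c i" for \<phi> c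
      proof -
        have "c i \<in> {1..d}" if i: "i < Suc d" for i
        proof -
          obtain v where "v \<in> Q i"
            using Q i by fastforce
          then show ?thesis
            using \<open>\<phi> ` ?A \<subseteq> {1..d}\<close> \<open>\<forall>i<Suc d. \<forall>v\<in>Q i. \<phi> v = c i\<close> i
            by (metis UN_I image_subset_iff lessThan_iff)
        qed
        then have "c ` {..<Suc d} \<subseteq> {1..d}"
          by auto
        with that(2) have "card {..<Suc d} \<le> card {1..d}"
          by (intro card_inj_on_le[of c]) auto
        then show False
          by simp
      qed
      ultimately show "\<exists>G. clique_glued G \<and> is_clique G ?A \<and> pverts G \<inter> X \<subseteq> ?A \<and>
        (\<forall>\<phi> c. \<phi> ` pverts G \<subseteq> {1..d} \<and> inj_on c {..<Suc d} \<and> (\<forall>i<Suc d. \<forall>v\<in>Q i. \<phi> v = c i) \<longrightarrow>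
          (\<exists>M. maximal_clique G M \<and> card M \<ge> 2 \<and> monochromatic \<phi> M \<and> \<not> M \<subseteq> ?A))"
        by (metis Int_lower1)
    qed
    then show ?case
      by auto
  next
    case (Suc j)
    then have *: "j \<le> Suc d" "Suc d - j = Suc (Suc d - Suc j)"
      by simp_all
    from Suc.IH[OF *(1)] show ?case
      unfolding *(2) using forcing_step by blast
  qed
  from this[of "Suc d"] show ?thesis
    by simp
qed

text \<open>With \<open>k = 0\<close> nothing is prescribed, so every coloring leaves a
  monochromatic maximal clique. Using \<open>Suc d\<close> colors keeps the palette nonempty even
  for \<open>d = 0\<close>; the constant coloring then shows that the graph is not null.\<close>

lemma clique_glued_not_clique_colorable:
  "\<exists>G :: nat pair_pre_digraph. clique_glued G \<and> pverts G \<noteq> {} \<and> \<not> clique_colorable d G"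
proof -
  obtain n where "forcing (Suc d) 0 n"
    using forcing_zero by blast
  then obtain G :: "nat pair_pre_digraph" where G: "clique_glued G"
    and mono: "\<And>\<phi>. \<phi> ` pverts G \<subseteq> {1..Suc d} \<Longrightarrow>
      \<exists>M. maximal_clique G M \<and> card M \<ge> 2 \<and> monochromatic \<phi> M \<and> \<not> M \<subseteq> {}"
    unfolding forcing_def by (auto simp: disjoint_family_on_def)
  have "\<exists>M. maximal_clique G M \<and> card M \<ge> 2 \<and> monochromatic (\<lambda>_. 1) M \<and> \<not> M \<subseteq> {}"
    by (rule mono) auto
  then have "pverts G \<noteq> {}"
    using maximal_clique_subset by blast
  moreover have "{1..d} \<subseteq> {1..Suc d}"
    by simp
  then have "\<not> clique_colorable d G"
    using mono unfolding clique_colorable_def clique_coloring_def by (meson subset_trans)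
  ultimately show ?thesis
    using G by blast
qed

text \<open>An injective coloring is a clique-coloring, so the least number of colors is attained; a
  clique-coloring with fewer than \<open>k\<close> colors is also one with \<open>k\<close>.\<close>

lemma clique_chromatic_number_ge:
  assumes "finite (pverts G)" "\<not> clique_colorable k G"
  shows "clique_chromatic_number G \<ge> k"
proof -
  obtain e where e: "bij_betw e (pverts G) {1..card (pverts G)}"
    using assms(1) finite_same_card_bij[of "pverts G" "{1..card (pverts G)}"] by auto
  have "\<not> monochromatic e M" if M: "maximal_clique G M" "card M \<ge> 2" for M
  proof
    assume "monochromatic e M"
    then obtain c where "\<forall>v\<in>M. e v = c"
      unfolding monochromatic_def by blast
    then have "card (e ` M) \<le> card {c}"
      by (intro card_mono) auto
    moreover have "inj_on e M"
      using e maximal_clique_subset[OF M(1)] unfolding bij_betw_def by (blast intro: inj_on_subset)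
    ultimately show False
      using M(2) by (simp add: card_image)
  qed
  then have "clique_colorable (card (pverts G)) G"
    using e unfolding clique_colorable_def clique_coloring_def bij_betw_def by blast
  then have "clique_colorable (clique_chromatic_number G) G"
    unfolding clique_chromatic_number_def by (rule LeastI)
  then obtain \<phi> where \<phi>: "clique_coloring G (clique_chromatic_number G) \<phi>"
    unfolding clique_colorable_def by blast
  show ?thesis
  proof (rule ccontr)
    assume "\<not> clique_chromatic_number G \<ge> k"
    then have "{1..clique_chromatic_number G} \<subseteq> {1..k}"
      by auto
    with \<phi> have "clique_coloring G k \<phi>"
      unfolding clique_coloring_def by blast
    with assms(2) show False
      unfolding clique_colorable_def by blast
  qed
qed

theorem mainTheorem3:
  shows "\<exists>\<G> :: nat pair_pre_digraph set.
           hereditary_class \<G> \<and>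
           (\<forall>G\<in>\<G>. perfect_graph G) \<and>
           (\<forall>G\<in>\<G>. cobipartite G \<or> (\<exists>K. clique_cutset G K)) \<and>
           (\<forall>G\<in>\<G>. cobipartite G \<longrightarrow> clique_colorable 2 G) \<and>
           (\<forall>k. \<exists>G\<in>\<G>. clique_chromatic_number G \<ge> k) \<and>
           \<not> (\<exists>d > 0. \<forall>G\<in>\<G>. clique_colorable d G)"
proof (rule exI[of _ "{G. clique_glued G \<and> pverts G \<noteq> {}}"], intro conjI)
  \<comment> \<open>The second condition removes the null graph, which \<open>clique_glued\<close>
    admits.\<close>
  let ?\<G> = "{G :: nat pair_pre_digraph. clique_glued G \<and> pverts G \<noteq> {}}"
  have "H \<in> ?\<G>" if "G \<in> ?\<G>" "digraph_iso (with_proj G) (with_proj H)" for G H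
    by (rule digraph_iso_with_projD[OF that(2)]) (use that(1) clique_glued_map in auto)
  moreover have "H \<in> ?\<G>" if "G \<in> ?\<G>" "is_induced_subgraph H G" for G H
    using is_induced_subgraphD[OF that(2)] that(1) clique_glued_induce[of G "pverts H"] by simp
  ultimately show "hereditary_class ?\<G>"
    unfolding hereditary_class_def graph_class_def simple_graph_def
    using clique_glued_pair_graph by blast
  show "\<forall>G\<in>?\<G>. perfect_graph G"
    using clique_glued_perfect by blast
  show "\<forall>G\<in>?\<G>. cobipartite G \<or> (\<exists>K. clique_cutset G K)"
    using clique_glued_cutset by blast
  show "\<forall>G\<in>?\<G>. cobipartite G \<longrightarrow> clique_colorable 2 G"
    using clique_glued_pair_graph cobipartite_2_clique_colorable by blast
  show "\<forall>k. \<exists>G\<in>?\<G>. clique_chromatic_number G \<ge> k"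
    using clique_glued_not_clique_colorable clique_glued_finite clique_chromatic_number_ge
    by (metis (lifting) mem_Collect_eq)
  show "\<not> (\<exists>d > 0. \<forall>G\<in>?\<G>. clique_colorable d G)"
    using clique_glued_not_clique_colorable by blast
qed

end
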